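(* Let $(\mathcal{V},\triangleright)$ be the pre-Lie algebra of planted decorated trees and monomials $X_0,\dots,X_d$ defined in the context. Define $\pi_0=0$, $\omega_0=\triangleright$; let $\pi_1:\wedge^2\mathcal{V}\to\mathcal{V}$ be the linear map with $\pi_1(I_a(\tau),X_i)=I_{a-e_i}(\tau)=-\pi_1(X_i,I_a(\tau))$ and $\pi_1=0$ on all other pairs of basis elements; let $\pi_i=0$ for $i\ge2$; and for $i\ge1$ let $\omega_i:\mathcal{V}\otimes\mathcal{V}\to\mathcal{V}$ be the linear map with $$\omega_i(I_a(\sigma),I_b(\tau))=\sum_{w\in N_\tau}\ \sum_{\ell\in\mathbb{N}^{d+1},\,|\ell|=i}\binom{\mathfrak{n}_w}{\ell}\,I_b\big(\sigma\curvearrowright_w^{a-\ell}(\uparrow_w^{-\ell}\tau)\big)$$ and $\omega_i=0$ on all other pairs of basis elements. Put $\pi_t=\sum_{i\ge0}\pi_it^i=\pi_1t$ and $\omega_t=\sum_{i\ge0}\omega_it^i$. Then $(\mathcal{V}[[t]],\pi_t,\omega_t)$ is an $\mathbb{R}[[t]]$-post-Lie algebra and $(\pi_t,\omega_t)$ is a formal post-Lie deformation of the pre-Lie algebra $(\mathcal{V},[\cdot,\cdot]_0=0,\triangleright)$.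
   Context: **Post-Lie algebras and formal deformations.** A post-Lie algebra $(\mathfrak{g},[\cdot,\cdot],\triangleright)$ (over a commutative ring) is a Lie algebra $(\mathfrak{g},[\cdot,\cdot])$ with a bilinear product $\triangleright$ such that $x\triangleright[y,z]=[x\triangleright y,z]+[y,x\triangleright z]$ and $([x,y]+x\triangleright y-y\triangleright x)\triangleright z=x\triangleright(y\triangleright z)-y\triangleright(x\triangleright z)$. A pre-Lie algebra is a post-Lie algebra with zero bracket. For a pre-Lie algebra $(\mathfrak{g},\triangleright)$ over $\mathbb{R}$ and $\pi_i\in\mathrm{Hom}_{\mathbb{R}}(\wedge^2\mathfrak{g},\mathfrak{g})$, $\omega_i\in\mathrm{Hom}_{\mathbb{R}}(\mathfrak{g}\otimes\mathfrak{g},\mathfrak{g})$, the series $\pi_t=\sum_i\pi_it^i$, $\omega_t=\sum_i\omega_it^i$ act on $\mathfrak{g}[[t]]$ by $\big(\sum_jx_jt^j,\sum_ky_kt^k\big)\mapsto\sum_{i,j,k}\pi_i(x_j,y_k)t^{i+j+k}$ (likewise $\omega_t$). $(\pi_t,\omega_t)$ is a formal post-Lie deformation of $(\mathfrak{g},\triangleright)$ if $(\mathfrak{g}[[t]],\pi_t,\omega_t)$ is an $\mathbb{R}[[t]]$-post-Lie algebra (bracket $\pi_t$, product $\omega_t$) and $(\pi_0,\omega_0)=(0,\triangleright)$. **Decorated trees.** Fix $d\ge0$; $\mathbb{N}$ contains $0$; $e_0,\dots,e_d$ is the standard basis of $\mathbb{N}^{d+1}$; $|\ell|=\ell_0+\dots+\ell_d$.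 A decorated tree is a (isomorphism class of) non-planar rooted tree $T$ with node set $N_T$ and edge set $E_T$, node decorations $\mathfrak{n}:N_T\to\mathbb{N}^{d+1}$ and edge decorations in $\{I,\Xi\}\times\mathbb{N}^{d+1}$. Edges of type $\Xi$ ("noise edges") are only decorated by $(\Xi,0)$, are terminal (their upper end is a leaf), have node decoration $0$ at that leaf, and at most one of them is attached to each node; all other edges are decorated by some $(I,a)$, $a\in\mathbb{N}^{d+1}$. Let $\mathfrak{T}$ be the set of decorated trees. $I_a(\tau)$ is the planted tree obtained by grafting the root of $\tau$ onto a new root, decorated by $0$, via a new edge decorated by $(I,a)$. $X_i$ is the single node decorated by $e_i$. Let $\mathcal{V}$ be the real vector space with basis $\{I_a(\tau):a\in\mathbb{N}^{d+1},\tau\in\mathfrak{T}\}\cup\{X_0,\dots,X_d\}$. Convention: $I_{a-e_i}(\tau)=0$ if $a-e_i\notin\mathbb{N}^{d+1}$. **Operations.** In all sums over nodes, leaves of noise edges are excluded (such terms are zero). For a node $w$ of $\tau$ with decoration $\mathfrak{n}_w$: $\sigma\curvearrowright^a_w\tau$ is the tree obtained by attaching the root of $\sigma$ to $w$ by a new edge decorated by $(I,a)$; $\uparrow_w^{m}\tau$ adds $m\in\mathbb{Z}^{d+1}$ to the decoration of $w$. Binomials of multi-indices are products of componentwise binomials, and terms in which $a-\ell$ or $\mathfrak{n}_w-\ell$ is not in $\mathbb{N}^{d+1}$ are zero. Set $\sigma\curvearrowright^a\tau=\sum_{w\in N_\tau}\sigma\curvearrowright^a_w\tau$ and $\uparrow^i\tau=\sum_{w\in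 N_\tau}\uparrow_w^{e_i}\tau$. **Pre-Lie product on $\mathcal{V}$.** $X_i\triangleright I_a(\tau)=I_a(\uparrow^i\tau)$, $I_a(\tau)\triangleright X_i=0$, $X_i\triangleright X_j=0$, $I_a(\sigma)\triangleright I_b(\tau)=I_b(\sigma\curvearrowright^a\tau)$. *)

theory Defs
  imports "HOL-Analysis.Analysis" "HOL-Analysis.Finite_Function_Topology" "HOL-Library.Multiset"
    "HOL-Computational_Algebra.Formal_Power_Series"
begin

section \<open>Post-Lie algebras over a commutative ring\<close>

definition bilinear_op :: "('r::comm_ring_1 \<Rightarrow> 'v::ab_group_add \<Rightarrow> 'v) \<Rightarrow> ('v \<Rightarrow> 'v \<Rightarrow> 'v) \<Rightarrow> bool" where
  "bilinear_op s f \<longleftrightarrow> (\<forall>x. module_hom s s (\<lambda>y. f x y)) \<and> (\<forall>y. module_hom s s (\<lambda>x. f x y))"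

locale post_lie_algebra = module scale
  for scale :: "'r::comm_ring_1 \<Rightarrow> 'v::ab_group_add \<Rightarrow> 'v" +
  fixes bracket :: "'v \<Rightarrow> 'v \<Rightarrow> 'v"
    and prod :: "'v \<Rightarrow> 'v \<Rightarrow> 'v"
  assumes bracket_bilinear: "bilinear_op scale bracket"
    and bracket_alternating: "bracket x x = 0"
    and jacobi: "bracket x (bracket y z) + bracket y (bracket z x) + bracket z (bracket x y) = 0"
    and prod_bilinear: "bilinear_op scale prod"
    and prod_derivation: "prod x (bracket y z) = bracket (prod x y) z + bracket y (prod x z)"
    and prod_bracket:
      "prod (bracket x y + prod x y - prod y x) z = prod x (prod y z) - prod y (prod x z)"

definition pre_lie_algebra :: "('r::comm_ring_1 \<Rightarrow> 'v::ab_group_add \<Rightarrow> 'v) \<Rightarrow> ('v \<Rightarrow> 'v \<Rightarrow> 'v) \<Rightarrow> bool" where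
  "pre_lie_algebra s p \<longleftrightarrow> post_lie_algebra s (\<lambda>_ _. 0) p"


section \<open>Formal post-Lie deformations\<close>

text \<open>\<^typ>\<open>'v fps\<close> is used as the module \<open>\<gg>[[t]]\<close> over the ring \<^typ>\<open>real fps\<close>; only its additive
  structure comes from the library, since \<^typ>\<open>'v\<close> carries no multiplication.\<close>

definition fps_act :: "real fps \<Rightarrow> 'v::real_vector fps \<Rightarrow> 'v fps" where
  "fps_act c x = Abs_fps (\<lambda>n. \<Sum>i\<le>n. fps_nth c i *\<^sub>R fps_nth x (n - i))"

lemma finite_sum_triples: "finite {(i, j, k). i + j + k = (n::nat)}"
  by (rule finite_subset[of _ "{..n} \<times> {..n} \<times> {..n}"]) auto

definition series_op :: "(nat \<Rightarrow> 'v \<Rightarrow> 'v \<Rightarrow> 'v) \<Rightarrow> 'v::real_vector fps \<Rightarrow> 'v fps \<Rightarrow> 'v fps" where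
  "series_op f x y =
    Abs_fps (\<lambda>n. \<Sum>(i, j, k) \<in> {(i, j, k). i + j + k = n}. f i (fps_nth x j) (fps_nth y k))"

text \<open>Elements of \<open>Hom(\<wedge>\<^sup>2\<gg>, \<gg>)\<close> are the alternating bilinear maps, elements of
  \<open>Hom(\<gg> \<otimes> \<gg>, \<gg>)\<close> the bilinear maps.\<close>

definition formal_post_lie_deformation ::
  "('v::real_vector \<Rightarrow> 'v \<Rightarrow> 'v) \<Rightarrow> (nat \<Rightarrow> 'v \<Rightarrow> 'v \<Rightarrow> 'v) \<Rightarrow> (nat \<Rightarrow> 'v \<Rightarrow> 'v \<Rightarrow> 'v) \<Rightarrow> bool" where
  "formal_post_lie_deformation p \<pi> \<omega> \<longleftrightarrow>
    pre_lie_algebra (*\<^sub>R) p \<and>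
    (\<forall>i. bilinear (\<pi> i) \<and> (\<forall>x. \<pi> i x x = 0)) \<and>
    (\<forall>i. bilinear (\<omega> i)) \<and>
    post_lie_algebra fps_act (series_op \<pi>) (series_op \<omega>) \<and>
    \<pi> 0 = (\<lambda>_ _. 0) \<and> \<omega> 0 = p"


section \<open>Decorated trees\<close>

text \<open>The index type \<^typ>\<open>'i::finite\<close> plays the role of \<open>{0, \<dots>, d}\<close>. It is an arbitrary nonempty
  finite type, so \<open>d = CARD('i) - 1 \<ge> 0\<close> is arbitrary; \<open>e\<^sub>i\<close> is \<^term>\<open>axis i (1::nat)\<close>, and the order
  and the (truncated) subtraction on \<^typ>\<open>nat ^ 'i\<close> are componentwise.\<close>

definition mi_size :: "nat ^ 'i::finite \<Rightarrow> nat" where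
  "mi_size l = (\<Sum>i\<in>UNIV. l $ i)"

lemma finite_mi_size: "finite {l :: nat ^ 'i::finite. mi_size l = m}"
proof (rule finite_subset)
  show "{l :: nat ^ 'i. mi_size l = m} \<subseteq> vec_lambda ` (UNIV \<rightarrow>\<^sub>E {..m})"
  proof safe
    fix l :: "nat ^ 'i" assume "m = mi_size l"
    then have "vec_nth l \<in> UNIV \<rightarrow>\<^sub>E {..mi_size l}"
      by (auto simp: mi_size_def intro: member_le_sum)
    then show "l \<in> vec_lambda ` (UNIV \<rightarrow>\<^sub>E {..mi_size l})"
      by (metis image_eqI vec_nth_inverse)
  qed
qed (intro finite_imageI finite_PiE, simp_all)

definition mi_binom :: "nat ^ 'i::finite \<Rightarrow> nat ^ 'i \<Rightarrow> nat" where
  "mi_binom n l = (\<Prod>i\<in>UNIV. (n $ i) choose (l $ i))"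

datatype edge_kind = I_edge | Xi_edge

text \<open>Isomorphism classes of non-planar rooted trees: a node with its decoration, and the multiset of
  its outgoing edges (with decoration), each with the subtree at its upper end.\<close>

datatype ('i::finite) tree =
  Node "nat ^ 'i" "((edge_kind \<times> (nat ^ 'i)) \<times> 'i tree) multiset"

inductive decorated :: "('i::finite) tree \<Rightarrow> bool" where
  "decorated (Node n B)"
  if "\<forall>(e, s) \<in># B. decorated s"
    and "\<forall>((k, a), s) \<in># B. k = Xi_edge \<longrightarrow> a = 0 \<and> s = Node 0 {#}"
    and "size {#((k, a), s) \<in># B. k = Xi_edge#} \<le> 1"

lemma decorated_Node:
  "decorated (Node n B) \<longleftrightarrow>
    (\<forall>(e, s) \<in># B. decorated s) \<and>
    (\<forall>((k, a), s) \<in># B. k = Xi_edge \<longrightarrow> a = 0 \<and> s = Node 0 {#}) \<and>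
    size {#((k, a), s) \<in># B. k = Xi_edge#} \<le> 1"
  by (subst decorated.simps) simp

typedef (overloaded) ('i::finite) dtree = "{t :: 'i tree. decorated t}"
  morphisms tree_of dtree_of
proof
  show "Node 0 {#} \<in> {t. decorated t}"
    by (auto intro: decorated.intros)
qed

lemma size_branch_less:
  assumes "(e, s) \<in># B"
  shows "size s < size (Node n B)"
proof -
  obtain B' where "B = add_mset (e, s) B'"
    using assms by (metis insert_DiffM)
  then have "B = B' + {#(e, s)#}"
    by simp
  then show ?thesis
    by (simp only: tree.size size_multiset_union size_multiset_single) simp
qed

lemma image_mset_cong_strong [fundef_cong]:
  "M = N \<Longrightarrow> (\<And>x. x \<in># N \<Longrightarrow> f x = g x) \<Longrightarrow> image_mset f M = image_mset g N"
  by (auto intro: image_mset_cong)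

text \<open>The nodes \<open>w\<close> of \<open>\<tau>\<close>, except the leaves of noise edges, counted with multiplicity. As the nodes
  of an isomorphism class have no names, \<open>w\<close> is represented by the pair of the subtree at \<open>w\<close> and the
  map \<open>C\<close> sending \<open>v\<close> to the tree obtained from \<open>\<tau>\<close> by replacing this subtree with \<open>v\<close>.\<close>

function nodes :: "('i::finite) tree \<Rightarrow> ('i tree \<times> ('i tree \<Rightarrow> 'i tree)) multiset" where
  "nodes (Node n B) =
    add_mset (Node n B, \<lambda>v. v)
      (\<Sum>(e, s) \<in># B.
        if fst e = Xi_edge then {#}
        else image_mset (\<lambda>(u, C). (u, \<lambda>v. Node n (add_mset (e, C v) (B - {#(e, s)#})))) (nodes s))"
  by pat_completeness auto
termination
  by (relation "Wellfounded.measure size") (auto intro: size_branch_less simp del: tree.size)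

fun root_dec :: "('i::finite) tree \<Rightarrow> nat ^ 'i" where
  "root_dec (Node n B) = n"

fun map_root_dec :: "(nat ^ 'i \<Rightarrow> nat ^ 'i) \<Rightarrow> ('i::finite) tree \<Rightarrow> 'i tree" where
  "map_root_dec f (Node n B) = Node (f n) B"

fun attach :: "nat ^ 'i \<Rightarrow> ('i::finite) tree \<Rightarrow> 'i tree \<Rightarrow> 'i tree" where
  "attach a \<sigma> (Node n B) = Node n (add_mset ((I_edge, a), \<sigma>) B)"

text \<open>These operations preserve \<^const>\<open>decorated\<close>, so that \<^const>\<open>dtree_of\<close> is only ever applied
  to decorated trees below.\<close>

lemma decorated_map_root_dec: "decorated u \<Longrightarrow> decorated (map_root_dec f u)"
  by (cases u) (auto simp: decorated_Node)

lemma decorated_attach: "decorated \<sigma> \<Longrightarrow> decorated u \<Longrightarrow> decorated (attach a \<sigma> u)"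
  by (cases u) (auto simp: decorated_Node)

lemma decorated_nodes:
  assumes "decorated t" "(u, C) \<in># nodes t"
  shows "decorated u" and "decorated v \<Longrightarrow> decorated (C v)"
proof -
  have "decorated u \<and> (decorated v \<longrightarrow> decorated (C v))"
    using assms
  proof (induction t arbitrary: u C rule: nodes.induct)
    case (1 n B)
    show ?case
    proof (cases "u = Node n B \<and> C = (\<lambda>v. v)")
      case False
      then obtain k a s C' where s: "((k, a), s) \<in># B" "k \<noteq> Xi_edge" "(u, C') \<in># nodes s"
        and C: "C = (\<lambda>v. Node n (add_mset ((k, a), C' v) (B - {#((k, a), s)#})))"
        using "1.prems"(2) by (auto split: if_splits)
      obtain B' where B: "B = add_mset ((k, a), s) B'"
        using s(1) by (metis insert_DiffM)
      have "decorated s"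
        using "1.prems"(1) by (simp add: B decorated_Node)
      then have "decorated u \<and> (decorated v \<longrightarrow> decorated (C' v))"
        using "1.IH"[OF s(1) refl] s(2,3) by simp
      moreover have "decorated v' \<Longrightarrow> decorated (Node n (add_mset ((k, a), v') B'))" for v'
        using "1.prems"(1) s(2) unfolding B by (auto simp: decorated_Node)
      ultimately show ?thesis
        by (simp add: C B)
    qed (use "1.prems" in auto)
  qed
  then show "decorated u" "decorated v \<Longrightarrow> decorated (C v)"
    by auto
qed


section \<open>The space \<open>\<V>\<close> and its operations\<close>

text \<open>The basis of \<open>\<V>\<close>: \<open>Planted a \<tau>\<close> stands for \<open>I\<^sub>a(\<tau>)\<close>. The underlying trees are given by
  \<open>gen_tree\<close>, which is injective.\<close>

datatype ('i::finite) gen = Planted "nat ^ 'i" "'i dtree" | X 'i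

type_synonym 'i V = "('i gen, real) poly_mapping"

primrec gen_tree :: "('i::finite) gen \<Rightarrow> 'i tree" where
  "gen_tree (Planted a \<tau>) = Node 0 {#((I_edge, a), tree_of \<tau>)#}"
| "gen_tree (X i) = Node (axis i 1) {#}"

lemma decorated_gen_tree: "decorated (gen_tree g)"
  using tree_of by (cases g) (auto intro!: decorated.intros)

lemma inj_gen_tree: "inj gen_tree"
  by (rule injI, rename_tac g h, case_tac g; case_tac h)
     (auto simp: axis_eq_axis tree_of_inject)

definition basis_vec :: "('i::finite) gen \<Rightarrow> 'i V" where
  "basis_vec g = Poly_Mapping.single g 1"

definition bilinear_ext ::
  "('i::finite gen \<Rightarrow> 'i gen \<Rightarrow> 'i V) \<Rightarrow> 'i V \<Rightarrow> 'i V \<Rightarrow> 'i V" where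
  "bilinear_ext f x y =
    (\<Sum>g \<in> Poly_Mapping.keys x. \<Sum>h \<in> Poly_Mapping.keys y.
       (Poly_Mapping.lookup x g * Poly_Mapping.lookup y h) *\<^sub>R f g h)"

fun prelie_gen :: "('i::finite) gen \<Rightarrow> 'i gen \<Rightarrow> 'i V" where
  "prelie_gen (X i) (Planted a \<tau>) =
    (\<Sum>(u, C) \<in># nodes (tree_of \<tau>).
       basis_vec (Planted a (dtree_of (C (map_root_dec (\<lambda>n. n + axis i 1) u)))))"
| "prelie_gen (Planted a \<sigma>) (Planted b \<tau>) =
    (\<Sum>(u, C) \<in># nodes (tree_of \<tau>).
       basis_vec (Planted b (dtree_of (C (attach a (tree_of \<sigma>) u)))))"
| "prelie_gen (Planted a \<tau>) (X i) = 0"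
| "prelie_gen (X i) (X j) = 0"

definition prelie :: "('i::finite) V \<Rightarrow> 'i V \<Rightarrow> 'i V" where
  "prelie = bilinear_ext prelie_gen"

definition lower_I :: "nat ^ 'i \<Rightarrow> ('i::finite) dtree \<Rightarrow> 'i \<Rightarrow> 'i V" where
  "lower_I a \<tau> i = (if axis i 1 \<le> a then basis_vec (Planted (a - axis i 1) \<tau>) else 0)"

fun pi1_gen :: "('i::finite) gen \<Rightarrow> 'i gen \<Rightarrow> 'i V" where
  "pi1_gen (Planted a \<tau>) (X i) = lower_I a \<tau> i"
| "pi1_gen (X i) (Planted a \<tau>) = - lower_I a \<tau> i"
| "pi1_gen (Planted a \<sigma>) (Planted b \<tau>) = 0"
| "pi1_gen (X i) (X j) = 0"

text \<open>The guard encodes the convention that terms in which \<open>a - \<ell>\<close> or \<open>\<nn>\<^sub>w - \<ell>\<close> leaves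
  \<open>\<nat>\<^bsup>d+1\<^esup>\<close> vanish.\<close>

fun omega_gen :: "nat \<Rightarrow> ('i::finite) gen \<Rightarrow> 'i gen \<Rightarrow> 'i V" where
  "omega_gen m (Planted a \<sigma>) (Planted b \<tau>) =
    (\<Sum>(u, C) \<in># nodes (tree_of \<tau>). \<Sum>l | mi_size l = m.
       if l \<le> a \<and> l \<le> root_dec u
       then real (mi_binom (root_dec u) l) *\<^sub>R
         basis_vec (Planted b (dtree_of
           (C (attach (a - l) (tree_of \<sigma>) (map_root_dec (\<lambda>n. n - l) u)))))
       else 0)"
| "omega_gen m (X i) h = 0"
| "omega_gen m g (X i) = 0"

definition pi_coeff :: "nat \<Rightarrow> ('i::finite) V \<Rightarrow> 'i V \<Rightarrow> 'i V" where
  "pi_coeff m = (if m = 1 then bilinear_ext pi1_gen else (\<lambda>_ _. 0))"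

definition omega_coeff :: "nat \<Rightarrow> ('i::finite) V \<Rightarrow> 'i V \<Rightarrow> 'i V" where
  "omega_coeff m = (if m = 0 then prelie else bilinear_ext (omega_gen m))"

end

(* Every axiom is an identity of power series in t, compared coefficient by coefficient on basis
   elements. For a basis element x of V, the product omega_t(x, I_c(tau)) is a sum over the nodes of
   tau of an operation at that node: for x = X_i, adding e_i to the decoration n_w; for x = I_a(sigma),
   the sum over l of (n_w choose l) t^|l| times grafting sigma at w by (I, a - l) while lowering n_w
   by l. In the commutator of two such operators, the terms at two different old nodes cancel; the
   terms where one operator acts inside the tree that the other one has grafted give
   x |> y - y |> x; and what remains is the commutator of the two operations at one node. There,
   two graftings commute because (n choose l)(n-l choose m) is symmetric in l and m, while by Pascal's
   rule grafting by a and adding e_i commute up to t times grafting by a - e_i. This defect is exactly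
   the action of the bracket pi_t(I_a(sigma), X_i). *)

theory Submission
  imports Defs
begin

section \<open>Formal series of bilinear operations\<close>

notation fps_nth (infixl "$$" 75)

text \<open>Indexes the coefficient of t^n in a doubly nested product: \<open>m\<close> is the power
  of t carried by the two operations together, \<open>a\<close>, \<open>b\<close>, \<open>c\<close>
  those carried by the three arguments.\<close>

definition quadruples :: "nat \<Rightarrow> (nat \<times> nat \<times> nat \<times> nat) set" where
  "quadruples n = {(m, a, b, c). m + a + b + c = n}"

lemma finite_quadruples: "finite (quadruples n)"
  by (rule finite_subset[of _ "{..n} \<times> {..n} \<times> {..n} \<times> {..n}"]) (auto simp: quadruples_def)

lemma series_op_nth:
  "series_op f x y $$ n = (\<Sum>(i, j, k) \<in> {(i, j, k). i + j + k = n}. f i (x $$ j) (y $$ k))"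
  by (simp add: series_op_def)

lemma fps_act_nth: "fps_act c x $$ n = (\<Sum>i\<le>n. (c $$ i) *\<^sub>R (x $$ (n - i)))"
  by (simp add: fps_act_def)

text \<open>Collecting the terms by the joint power \<open>m\<close> isolates inner sums over
  \<open>i\<close> that involve only the operations on coefficients, so the axioms can be checked
  one \<open>m\<close> at a time.\<close>

lemma series_op_nested_right:
  assumes "\<And>i x. linear (f i x)"
  shows "series_op f x (series_op g y z) $$ n =
    (\<Sum>(m, a, b, c) \<in> quadruples n. \<Sum>i\<le>m. f i (x $$ a) (g (m - i) (y $$ b) (z $$ c)))"
proof -
  let ?T = "\<lambda>n::nat. {(i, j, k). i + j + k = n}"
  have "series_op f x (series_op g y z) $$ n =
    (\<Sum>(p, q) \<in> Sigma (?T n) (\<lambda>(i, j, k). ?T k).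
       (case p of (i, a, k) \<Rightarrow> case q of (i', b, c) \<Rightarrow> f i (x $$ a) (g i' (y $$ b) (z $$ c))))"
    by (subst sum.Sigma[symmetric])
      (auto simp: series_op_nth finite_sum_triples finite_sum_triples[unfolded split_def] linear_sum[OF assms] split_def intro!: sum.cong)
  \<comment> \<open>The triples (i, a, k) and (i', b, c) with k = i' + b + c are traded for m = i +
    i' together with the splitting of m into i and m - i.\<close>
  moreover have "\<dots> = (\<Sum>(q, i) \<in> Sigma (quadruples n) (\<lambda>(m, a, b, c). {..m}).
       (case q of (m, a, b, c) \<Rightarrow> f i (x $$ a) (g (m - i) (y $$ b) (z $$ c))))"
    by (rule sum.reindex_bij_witness[of _
          "\<lambda>((m, a, b, c), i). ((i, a, m - i + b + c), (m - i, b, c))"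
          "\<lambda>((i, a, k), (i', b, c)). ((i + i', a, b, c), i)"])
      (auto simp: quadruples_def)
  moreover have "\<dots> = (\<Sum>(m, a, b, c) \<in> quadruples n. \<Sum>i\<le>m. f i (x $$ a) (g (m - i) (y $$ b) (z $$ c)))"
    by (subst sum.Sigma[symmetric])
      (auto simp: finite_quadruples split_def intro!: sum.cong)
  ultimately show ?thesis by (simp only:)
qed

text \<open>Reduces statements about the left argument to those about the right argument.\<close>

lemma series_op_swap: "series_op f x y = series_op (\<lambda>i u v. f i v u) y x"
proof (rule fps_ext)
  fix n
  show "series_op f x y $$ n = series_op (\<lambda>i u v. f i v u) y x $$ n"
    unfolding series_op_nth
    by (rule sum.reindex_bij_witness[of _ "\<lambda>(i, j, k). (i, k, j)" "\<lambda>(i, j, k). (i, k, j)"]) auto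
qed

lemma sum_quadruples_rotate:
  "(\<Sum>(m, a, b, c) \<in> quadruples n. h m a b c) = (\<Sum>(m, a, b, c) \<in> quadruples n. h m b c a)"
  by (rule sum.reindex_bij_witness[of _ "\<lambda>(m, a, b, c). (m, b, c, a)" "\<lambda>(m, a, b, c). (m, c, a, b)"])
    (auto simp: quadruples_def)

lemma sum_quadruples_swap:
  "(\<Sum>(m, a, b, c) \<in> quadruples n. h m a b c) = (\<Sum>(m, a, b, c) \<in> quadruples n. h m b a c)"
  by (rule sum.reindex_bij_witness[of _ "\<lambda>(m, a, b, c). (m, b, a, c)" "\<lambda>(m, a, b, c). (m, b, a, c)"])
    (auto simp: quadruples_def)

text \<open>After exchanging the two arguments the nested factor stands on the right; a cyclic
  renaming of the indices restores the order x, y, z.\<close>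

lemma series_op_nested_left:
  assumes "\<And>i y. linear (\<lambda>x. f i x y)"
  shows "series_op f (series_op g x y) z $$ n =
    (\<Sum>(m, a, b, c) \<in> quadruples n. \<Sum>i\<le>m. f i (g (m - i) (x $$ a) (y $$ b)) (z $$ c))"
  unfolding series_op_swap[of f "series_op g x y"]
  by (subst series_op_nested_right[OF assms], subst sum_quadruples_rotate) simp

section \<open>The R[[t]]-module structure and bilinearity of series operations\<close>

lemma module_fps_act: "module (fps_act :: real fps \<Rightarrow> 'v::real_vector fps \<Rightarrow> 'v fps)"
proof
  fix a b :: "real fps" and x y :: "'v fps"
  show "fps_act a (x + y) = fps_act a x + fps_act a y"
    by (rule fps_ext) (simp add: fps_act_nth scaleR_add_right sum.distrib)
  show "fps_act (a + b) x = fps_act a x + fps_act b x"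
    by (rule fps_ext) (simp add: fps_act_nth scaleR_add_left sum.distrib)
  show "fps_act 1 x = x"
  proof (rule fps_ext)
    fix n
    have "fps_act 1 x $$ n = (\<Sum>i\<le>n. if i = 0 then x $$ n else 0)"
      unfolding fps_act_nth by (intro sum.cong) auto
    then show "fps_act 1 x $$ n = x $$ n" by simp
  qed
  show "fps_act a (fps_act b x) = fps_act (a * b) x"
  proof (rule fps_ext)
    fix n
    have "fps_act a (fps_act b x) $$ n =
      (\<Sum>(i, j) \<in> Sigma {..n} (\<lambda>i. {..n - i}). (a $$ i * b $$ j) *\<^sub>R (x $$ (n - i - j)))"
      by (subst sum.Sigma[symmetric]) (auto simp: fps_act_nth scaleR_sum_right)
    moreover have "\<dots> = (\<Sum>(k, i) \<in> Sigma {..n} (\<lambda>k. {0..k}). (a $$ i * b $$ (k - i)) *\<^sub>R (x $$ (n - k)))"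
      by (rule sum.reindex_bij_witness[of _ "\<lambda>(k, i). (i, k - i)" "\<lambda>(i, j). (i + j, i)"]) auto
    moreover have "\<dots> = fps_act (a * b) x $$ n"
      by (subst sum.Sigma[symmetric]) (auto simp: fps_act_nth fps_mult_nth scaleR_sum_left)
    ultimately show "fps_act a (fps_act b x) $$ n = fps_act (a * b) x $$ n" by (simp only:)
  qed
qed

lemma series_op_act_right:
  assumes "\<And>i x. linear (f i x)"
  shows "series_op f x (fps_act c y) = fps_act c (series_op f x y)"
proof (rule fps_ext)
  fix n
  let ?T = "\<lambda>n::nat. {(i, j, k). i + j + k = n}"
  have "series_op f x (fps_act c y) $$ n =
    (\<Sum>(p, q) \<in> Sigma (?T n) (\<lambda>(i, j, k). {..k}).
       (case p of (i, j, k) \<Rightarrow> (c $$ q) *\<^sub>R f i (x $$ j) (y $$ (k - q))))"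
    by (subst sum.Sigma[symmetric])
      (auto simp: series_op_nth fps_act_nth finite_sum_triples finite_sum_triples[unfolded split_def] linear_sum[OF assms]
        linear_scale[OF assms] split_def intro!: sum.cong)
  moreover have "\<dots> = (\<Sum>(q, p) \<in> Sigma {..n} (\<lambda>q. ?T (n - q)).
       (case p of (i, j, k) \<Rightarrow> (c $$ q) *\<^sub>R f i (x $$ j) (y $$ k)))"
    by (rule sum.reindex_bij_witness[of _ "\<lambda>(q, (i, j, k)). ((i, j, k + q), q)"
          "\<lambda>((i, j, k), q). (q, (i, j, k - q))"]) auto
  moreover have "\<dots> = fps_act c (series_op f x y) $$ n"
    by (subst sum.Sigma[symmetric])
      (auto simp: series_op_nth fps_act_nth finite_sum_triples finite_sum_triples[unfolded split_def] scaleR_sum_right split_def intro!: sum.cong)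
  ultimately show "series_op f x (fps_act c y) $$ n = fps_act c (series_op f x y) $$ n" by (simp only:)
qed

lemma series_op_add_right:
  assumes "\<And>i x. linear (f i x)"
  shows "series_op f x (y + z) = series_op f x y + series_op f x z"
  by (rule fps_ext) (simp add: series_op_nth linear_add[OF assms] sum.distrib split_def)

lemma bilinear_series_op:
  assumes "\<And>i. bilinear (f i)"
  shows "bilinear_op fps_act (series_op f)"
proof -
  have r: "linear (f i x)" and l: "linear (\<lambda>x. f i x y)" for i x y
    using assms by (auto simp: bilinear_def)
  have *: "module_hom fps_act fps_act (series_op g x)" if "\<And>i x. linear (g i x)" for g and x :: "'a fps"
    by (intro module_hom.intro module_hom_axioms.intro module_fps_act series_op_act_right[OF that]
        series_op_add_right[OF that])
  show ?thesis
    unfolding bilinear_op_def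
    by (auto simp: *[OF r] series_op_swap[of f _ y for y] *[OF l])
qed

text \<open>Polarization makes each \<open>f i\<close> antisymmetric, so exchanging the arguments
  turns the series into its negative; halving over the reals gives zero.\<close>

lemma series_op_alternating:
  assumes "\<And>i. bilinear (f i)" and alt: "\<And>i x. f i x x = 0"
  shows "series_op f x x = 0"
proof -
  have "f i v u = - f i u v" for i u v
    using alt[of i "u + v"] alt[of i u] alt[of i v]
    by (simp add: bilinear_ladd[OF assms(1)] bilinear_radd[OF assms(1)] eq_neg_iff_add_eq_0 add.commute)
  then have "(\<lambda>i u v. f i v u) = (\<lambda>i u v. - f i u v)"
    by (intro ext)
  then have "series_op f x x = series_op (\<lambda>i u v. - f i u v) x x"
    by (subst series_op_swap) (simp only:)
  moreover have "\<dots> = - series_op f x x"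
    by (rule fps_ext) (simp add: series_op_nth sum_negf split_def)
  ultimately have "series_op f x x $$ n = - (series_op f x x $$ n)" for n
    by (metis fps_neg_nth)
  then have "2 *\<^sub>R (series_op f x x $$ n) = 0" for n
    by (metis add.right_inverse scaleR_2)
  then show ?thesis
    by (intro fps_ext) simp
qed

text \<open>Each identity assumed is the coefficient of t^n in an axiom evaluated on constant
  series; the expansion over \<open>quadruples\<close> carries it to all series.\<close>

theorem post_lie_algebra_series:
  fixes br pr :: "nat \<Rightarrow> 'v::real_vector \<Rightarrow> 'v \<Rightarrow> 'v"
  assumes br: "\<And>i. bilinear (br i)" and pr: "\<And>i. bilinear (pr i)"
    and alt: "\<And>i x. br i x x = 0"
    and jac: "\<And>n x y z. (\<Sum>i\<le>n. br i x (br (n - i) y z) + br i y (br (n - i) z x)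
      + br i z (br (n - i) x y)) = 0"
    and der: "\<And>n x y z. (\<Sum>i\<le>n. pr i x (br (n - i) y z)) =
      (\<Sum>i\<le>n. br i (pr (n - i) x y) z + br i y (pr (n - i) x z))"
    and assoc: "\<And>n x y z. (\<Sum>i\<le>n. pr i (br (n - i) x y + pr (n - i) x y - pr (n - i) y x) z) =
      (\<Sum>i\<le>n. pr i x (pr (n - i) y z) - pr i y (pr (n - i) x z))"
  shows "post_lie_algebra fps_act (series_op br) (series_op pr)"
proof -
  have lin: "linear (br i x)" "linear (\<lambda>x. br i x y)" "linear (pr i x)" "linear (\<lambda>x. pr i x y)" for i x y
    using br pr by (auto simp: bilinear_def)
  note nested = series_op_nested_right[of br, OF lin(1)] series_op_nested_right[of pr, OF lin(3)]
    series_op_nested_left[of br, OF lin(2)] series_op_nested_left[of pr, OF lin(4)]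
  show ?thesis
  proof (intro post_lie_algebra.intro post_lie_algebra_axioms.intro module_fps_act
      bilinear_series_op br pr series_op_alternating alt)
    fix x y z :: "'v fps"
    show "series_op br x (series_op br y z) + series_op br y (series_op br z x)
        + series_op br z (series_op br x y) = 0" (is "?l = 0")
    proof (rule fps_ext)
      fix n
      \<comment> \<open>The second and third sums are rotated once and twice, so that x, y, z have
        the indices a, b, c in all three.\<close>
      have "?l $$ n = (\<Sum>(m, a, b, c) \<in> quadruples n. \<Sum>i\<le>m. br i (x $$ a) (br (m - i) (y $$ b) (z $$ c)))
        + (\<Sum>(m, a, b, c) \<in> quadruples n. \<Sum>i\<le>m. br i (y $$ b) (br (m - i) (z $$ c) (x $$ a)))
        + (\<Sum>(m, a, b, c) \<in> quadruples n. \<Sum>i\<le>m. br i (z $$ c) (br (m - i) (x $$ a) (y $$ b)))"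
        unfolding fps_add_nth nested
        by (subst (2) sum_quadruples_rotate, subst (3) sum_quadruples_rotate,
            subst (3) sum_quadruples_rotate) (rule refl)
      moreover have "\<dots> = (\<Sum>(m, a, b, c) \<in> quadruples n. \<Sum>i\<le>m.
          br i (x $$ a) (br (m - i) (y $$ b) (z $$ c)) + br i (y $$ b) (br (m - i) (z $$ c) (x $$ a))
          + br i (z $$ c) (br (m - i) (x $$ a) (y $$ b)))"
        by (simp add: sum.distrib split_def)
      ultimately show "?l $$ n = 0 $$ n"
        by (simp add: jac split_def)
    qed
    show "series_op pr x (series_op br y z) =
        series_op br (series_op pr x y) z + series_op br y (series_op pr x z)"
    proof (rule fps_ext)
      fix n
      have "series_op br y (series_op pr x z) $$ n =
          (\<Sum>(m, a, b, c) \<in> quadruples n. \<Sum>i\<le>m. br i (y $$ b) (pr (m - i) (x $$ a) (z $$ c)))"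
        unfolding nested by (rule sum_quadruples_swap)
      then show "series_op pr x (series_op br y z) $$ n =
          (series_op br (series_op pr x y) z + series_op br y (series_op pr x z)) $$ n"
        unfolding fps_add_nth by (simp add: nested der sum.distrib split_def)
    qed
    show "series_op pr (series_op br x y + series_op pr x y - series_op pr y x) z =
        series_op pr x (series_op pr y z) - series_op pr y (series_op pr x z)"
    proof (rule fps_ext)
      fix n
      have swap: "series_op pr y (series_op pr x z) $$ n =
          (\<Sum>(m, a, b, c) \<in> quadruples n. \<Sum>i\<le>m. pr i (y $$ b) (pr (m - i) (x $$ a) (z $$ c)))"
        "series_op pr (series_op pr y x) z $$ n =
          (\<Sum>(m, a, b, c) \<in> quadruples n. \<Sum>i\<le>m. pr i (pr (m - i) (y $$ b) (x $$ a)) (z $$ c))"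
        unfolding nested by (rule sum_quadruples_swap)+
      have add: "series_op pr (u + v) w = series_op pr u w + series_op pr v w"
        and diff: "series_op pr (u - v) w = series_op pr u w - series_op pr v w" for u v w :: "'v fps"
        using bilinear_series_op[of pr, OF pr]
        by (auto simp: bilinear_op_def intro: module_hom.add module_hom.diff)
      let ?h = "\<lambda>m a b c. (\<Sum>i\<le>m. pr i (br (m - i) (x $$ a) (y $$ b)) (z $$ c))
        + (\<Sum>i\<le>m. pr i (pr (m - i) (x $$ a) (y $$ b)) (z $$ c))
        - (\<Sum>i\<le>m. pr i (pr (m - i) (y $$ b) (x $$ a)) (z $$ c))"
      have "?h m a b c = (\<Sum>i\<le>m. pr i (x $$ a) (pr (m - i) (y $$ b) (z $$ c)))
        - (\<Sum>i\<le>m. pr i (y $$ b) (pr (m - i) (x $$ a) (z $$ c)))" for m a b c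
        using assoc[of m "x $$ a" "y $$ b" "z $$ c"]
        by (simp add: sum.distrib sum_subtractf linear_add[OF lin(4)] linear_diff[OF lin(4)])
      then have "(\<Sum>(m, a, b, c) \<in> quadruples n. ?h m a b c) = (\<Sum>(m, a, b, c) \<in> quadruples n.
          (\<Sum>i\<le>m. pr i (x $$ a) (pr (m - i) (y $$ b) (z $$ c)))
          - (\<Sum>i\<le>m. pr i (y $$ b) (pr (m - i) (x $$ a) (z $$ c))))"
        by simp
      then show "series_op pr (series_op br x y + series_op pr x y - series_op pr y x) z $$ n =
          (series_op pr x (series_op pr y z) - series_op pr y (series_op pr x z)) $$ n"
        unfolding add diff fps_sub_nth fps_add_nth unfolding swap unfolding nested
        by (simp only: split_def sum.distrib sum_subtractf)
    qed
  qed
qed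


section \<open>Finite linear combinations of evaluations\<close>

text \<open>A finite formal linear combination of points of \<open>S\<close>, encoded by its pairing
  with an arbitrary function \<kappa>. Feeding one combination into another is then composition of
  functionals.\<close>

inductive lincomb :: "'x set \<Rightarrow> (('x \<Rightarrow> 'v::real_vector) \<Rightarrow> 'v) \<Rightarrow> bool" for S where
  lincomb_zero: "lincomb S (\<lambda>_. 0)"
| lincomb_step: "x \<in> S \<Longrightarrow> lincomb S \<Phi> \<Longrightarrow> lincomb S (\<lambda>\<kappa>. c *\<^sub>R \<kappa> x + \<Phi> \<kappa>)"

lemma lincomb_eval: "x \<in> S \<Longrightarrow> lincomb S (\<lambda>\<kappa>. \<kappa> x)"
  using lincomb_step[OF _ lincomb_zero, of x S 1] by simp

lemma lincomb_add: "lincomb S \<Phi> \<Longrightarrow> lincomb S \<Psi> \<Longrightarrow> lincomb S (\<lambda>\<kappa>. \<Phi> \<kappa> + \<Psi> \<kappa>)"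
  by (induction rule: lincomb.induct) (auto simp: add.assoc intro: lincomb_step)

lemma lincomb_scale: "lincomb S \<Phi> \<Longrightarrow> lincomb S (\<lambda>\<kappa>. c *\<^sub>R \<Phi> \<kappa>)"
  by (induction rule: lincomb.induct) (auto simp: scaleR_add_right intro: lincomb_zero lincomb_step)

lemma lincomb_sum: "(\<And>i. i \<in> A \<Longrightarrow> lincomb S (\<Phi> i)) \<Longrightarrow> lincomb S (\<lambda>\<kappa>. \<Sum>i\<in>A. \<Phi> i \<kappa>)"
  by (induction A rule: infinite_finite_induct) (auto intro: lincomb_zero lincomb_add)

lemma lincomb_sum_mset:
  "(\<And>i. i \<in># A \<Longrightarrow> lincomb S (\<Phi> i)) \<Longrightarrow> lincomb S (\<lambda>\<kappa>. \<Sum>i\<in>#A. \<Phi> i \<kappa>)"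
  by (induction A) (auto intro: lincomb_zero lincomb_add)

lemma lincomb_bind:
  assumes "lincomb S \<Phi>" and "\<And>x. x \<in> S \<Longrightarrow> lincomb T (\<Psi> x)"
  shows "lincomb T (\<lambda>\<kappa>. \<Phi> (\<lambda>x. \<Psi> x \<kappa>))"
  using assms(1)
proof (induction rule: lincomb.induct)
  case (lincomb_step x \<Phi> c)
  then show ?case
    by (intro lincomb_add lincomb_scale assms(2))
qed (rule lincomb_zero)

text \<open>Makes it enough to know \<kappa> on decorated trees, where \<open>dtree_of\<close> is
  meaningful.\<close>

lemma lincomb_cong: "lincomb S \<Phi> \<Longrightarrow> (\<And>x. x \<in> S \<Longrightarrow> \<kappa> x = \<kappa>' x) \<Longrightarrow> \<Phi> \<kappa> = \<Phi> \<kappa>'"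
  by (induction rule: lincomb.induct) auto

lemma lincomb_linear: "lincomb S \<Phi> \<Longrightarrow> linear f \<Longrightarrow> f (\<Phi> \<kappa>) = \<Phi> (\<lambda>x. f (\<kappa> x))"
  by (induction rule: lincomb.induct) (auto simp: linear_0 linear_add linear_scale)

lemma lincomb_fun_zero: "lincomb S \<Phi> \<Longrightarrow> \<Phi> (\<lambda>_. 0) = 0"
  by (induction rule: lincomb.induct) auto

lemma lincomb_fun_add: "lincomb S \<Phi> \<Longrightarrow> \<Phi> (\<lambda>x. f x + g x) = \<Phi> f + \<Phi> g"
  by (induction rule: lincomb.induct) (auto simp: algebra_simps)

lemma lincomb_fun_scale: "lincomb S \<Phi> \<Longrightarrow> \<Phi> (\<lambda>x. c *\<^sub>R f x) = c *\<^sub>R \<Phi> f"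
  by (induction rule: lincomb.induct) (auto simp: algebra_simps)

lemma lincomb_fun_sum: "lincomb S \<Phi> \<Longrightarrow> \<Phi> (\<lambda>x. \<Sum>i\<in>A. f i x) = (\<Sum>i\<in>A. \<Phi> (f i))"
proof (induction A rule: infinite_finite_induct)
  case (insert i A)
  then show ?case
    using lincomb_fun_add[of S \<Phi> "f i" "\<lambda>x. \<Sum>i\<in>A. f i x"] by simp
qed (auto simp: lincomb_fun_zero)

text \<open>Two finite sums may be exchanged. This is what makes operations at two different nodes
  commute.\<close>

lemma lincomb_swap:
  assumes "lincomb S \<Phi>" "lincomb T \<Psi>"
  shows "\<Phi> (\<lambda>x. \<Psi> (F x)) = \<Psi> (\<lambda>y. \<Phi> (\<lambda>x. F x y))"
  using assms(1)
  by (induction rule: lincomb.induct)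
    (simp_all add: lincomb_fun_zero[OF assms(2)] lincomb_fun_add[OF assms(2)] lincomb_fun_scale[OF assms(2)])


section \<open>Sums of local operations over the nodes of a tree\<close>

type_synonym 'i branch = "(edge_kind \<times> (nat ^ 'i)) \<times> 'i tree"

text \<open>A local operation replaces the decoration of a node and adds branches to it. It depends on the
  old decoration only and yields a linear combination, which is represented by its pairing with a
  function on the results.\<close>

type_synonym ('i, 'v) local_op = "nat ^ 'i \<Rightarrow> ((nat ^ 'i) \<times> 'i branch multiset \<Rightarrow> 'v) \<Rightarrow> 'v"

text \<open>Branches that may be added to any decorated node: as no noise edge is among them, the
  bound of one noise edge per node stays satisfied.\<close>

definition graftable :: "((nat ^ 'i::finite) \<times> 'i branch multiset) set" where
  "graftable = {p. \<forall>((k, a), s) \<in># snd p. k = I_edge \<and> decorated s}"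

definition is_local :: "('i::finite, 'v::real_vector) local_op \<Rightarrow> bool" where
  "is_local L \<longleftrightarrow> (\<forall>n. lincomb graftable (L n))"

fun at_root :: "('i::finite, 'v::real_vector) local_op \<Rightarrow> 'i tree \<Rightarrow> ('i tree \<Rightarrow> 'v) \<Rightarrow> 'v" where
  "at_root L (Node n B) \<kappa> = L n (\<lambda>p. \<kappa> (Node (fst p) (snd p + B)))"

definition node_sum :: "('i::finite, 'v::real_vector) local_op \<Rightarrow> 'i tree \<Rightarrow> ('i tree \<Rightarrow> 'v) \<Rightarrow> 'v" where
  "node_sum L t \<kappa> = (\<Sum>(u, C) \<in># nodes t. at_root L u (\<lambda>v. \<kappa> (C v)))"

definition branch_sum ::
  "('i::finite, 'v::real_vector) local_op \<Rightarrow> 'i branch \<Rightarrow> ('i branch \<Rightarrow> 'v) \<Rightarrow> 'v" where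
  "branch_sum L b \<kappa> = (if fst (fst b) = Xi_edge then 0 else node_sum L (snd b) (\<lambda>v. \<kappa> (fst b, v)))"

definition branches_sum ::
  "('i::finite, 'v::real_vector) local_op \<Rightarrow> 'i branch multiset \<Rightarrow> ('i branch multiset \<Rightarrow> 'v) \<Rightarrow> 'v" where
  "branches_sum L B \<kappa> = (\<Sum>b \<in># B. branch_sum L b (\<lambda>b'. \<kappa> (add_mset b' (B - {#b#}))))"

lemma sum_mset_sum_mset: "sum_mset (image_mset f (\<Sum>x\<in>#A. g x)) = (\<Sum>x\<in>#A. \<Sum>y\<in>#g x. f y)"
  by (induction A) auto

text \<open>A node is either the root or lies in one of the branches. This recursion replaces the
  contexts \<open>C\<close> of \<open>nodes\<close> in the arguments about commutators.\<close>

lemma node_sum_Node: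
  "node_sum L (Node n B) \<kappa> = at_root L (Node n B) \<kappa> + branches_sum L B (\<lambda>B'. \<kappa> (Node n B'))"
proof -
  have "(\<Sum>(u, C) \<in># (\<Sum>(e, s) \<in># B. if fst e = Xi_edge then {#}
      else image_mset (\<lambda>(u, C). (u, \<lambda>v. Node n (add_mset (e, C v) (B - {#(e, s)#})))) (nodes s)).
      at_root L u (\<lambda>v. \<kappa> (C v))) =
    branches_sum L B (\<lambda>B'. \<kappa> (Node n B'))"
    unfolding branches_sum_def branch_sum_def node_sum_def sum_mset_sum_mset
    by (intro arg_cong[of _ _ sum_mset] image_mset_cong)
      (auto simp: split_def image_mset.compositionality comp_def intro!: arg_cong[of _ _ sum_mset])
  then show ?thesis
    by (simp add: node_sum_def)
qed

lemma branches_sum_empty [simp]: "branches_sum L {#} \<kappa> = 0"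
  by (simp add: branches_sum_def)

text \<open>A Leibniz rule: the operation acts either in the new branch or in one of the old
  ones.\<close>

lemma branches_sum_add:
  "branches_sum L (add_mset b B) \<kappa> =
    branch_sum L b (\<lambda>b'. \<kappa> (add_mset b' B)) + branches_sum L B (\<lambda>B'. \<kappa> (add_mset b B'))"
proof -
  \<comment> \<open>Since \<open>c\<close> occurs in \<open>B\<close>, it can be removed from
    \<open>B\<close> before \<open>b\<close> is added, even if \<open>c\<close> equals
    \<open>b\<close>.\<close>
  have "(\<Sum>c\<in>#B. branch_sum L c (\<lambda>b'. \<kappa> (add_mset b' (add_mset b B - {#c#})))) =
    (\<Sum>c\<in>#B. branch_sum L c (\<lambda>b'. \<kappa> (add_mset b (add_mset b' (B - {#c#})))))"
    by (intro arg_cong[of _ _ sum_mset] image_mset_cong)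
      (auto simp: add_mset_commute dest!: multi_member_split)
  then show ?thesis
    by (simp add: branches_sum_def)
qed

lemma branches_sum_union:
  "branches_sum L (A + B) \<kappa> =
    branches_sum L A (\<lambda>A'. \<kappa> (A' + B)) + branches_sum L B (\<lambda>B'. \<kappa> (A + B'))"
  by (induction A arbitrary: \<kappa>) (auto simp: branches_sum_add)

lemma at_root_lincomb:
  assumes "is_local L"
  shows "lincomb UNIV (at_root L u)"
proof (cases u)
  case (Node n B)
  then have eq: "at_root L u = (\<lambda>\<kappa>. L n (\<lambda>p. \<kappa> (Node (fst p) (snd p + B))))"
    by auto
  have "lincomb graftable (L n)"
    using assms by (simp add: is_local_def)
  then show ?thesis
    unfolding eq by (rule lincomb_bind) (simp add: lincomb_eval)
qed

lemma at_root_lincomb_decorated: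
  assumes "is_local L" "decorated u"
  shows "lincomb (Collect decorated) (at_root L u)"
proof (cases u)
  case (Node n B)
  have eq: "at_root L u = (\<lambda>\<kappa>. L n (\<lambda>p. \<kappa> (Node (fst p) (snd p + B))))"
    by (auto simp: Node)
  have dec: "decorated (Node (fst p) (snd p + B))" if "p \<in> graftable" for p
  proof -
    \<comment> \<open>The added branches contain no noise edge, so the number of noise edges at the
      root is unchanged.\<close>
    have none: "{#((k, a), s) \<in># snd p. k = Xi_edge#} = {#}"
      using that by (auto simp: graftable_def split_def)
    show ?thesis
      using assms(2) that unfolding Node decorated_Node filter_union_mset size_union none graftable_def
      by (auto simp: split_def)
  qed
  have "lincomb graftable (L n)"
    using assms by (simp add: is_local_def)
  then show ?thesis
    unfolding eq by (rule lincomb_bind) (simp add: lincomb_eval dec)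
qed

lemma node_sum_lincomb:
  assumes "is_local L"
  shows "lincomb UNIV (node_sum L t)"
proof -
  have "node_sum L t = (\<lambda>\<kappa>. \<Sum>(u, C) \<in># nodes t. at_root L u (\<lambda>v. \<kappa> (C v)))"
    by (auto simp: node_sum_def)
  then show ?thesis
    by (auto intro!: lincomb_sum_mset lincomb_bind[OF at_root_lincomb[OF assms]] lincomb_eval)
qed

lemma node_sum_lincomb_decorated:
  assumes "is_local L" "decorated t"
  shows "lincomb (Collect decorated) (node_sum L t)"
proof -
  have "node_sum L t = (\<lambda>\<kappa>. \<Sum>(u, C) \<in># nodes t. at_root L u (\<lambda>v. \<kappa> (C v)))"
    by (auto simp: node_sum_def)
  then show ?thesis
    using decorated_nodes[OF assms(2)]
    by (auto intro!: lincomb_sum_mset lincomb_bind[OF at_root_lincomb_decorated[OF assms(1)]] lincomb_eval)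
qed

lemma branch_sum_lincomb: "is_local L \<Longrightarrow> lincomb UNIV (branch_sum L b)"
  unfolding branch_sum_def
  by (cases "fst (fst b) = Xi_edge")
    (simp_all add: lincomb_zero lincomb_bind[OF node_sum_lincomb] lincomb_eval)

lemma branches_sum_lincomb:
  assumes "is_local L"
  shows "lincomb UNIV (branches_sum L B)"
  unfolding branches_sum_def
  by (auto intro!: lincomb_sum_mset lincomb_bind[OF branch_sum_lincomb[OF assms]] lincomb_eval)

text \<open>In the first difference both operations act at the same node and their added branches
  accumulate. In the second, one operation acts inside the branches that the other has just added
  there.\<close>

definition local_commutator ::
  "('i::finite, 'v::real_vector) local_op \<Rightarrow> ('i, 'v) local_op \<Rightarrow> ('i, 'v) local_op" where
  "local_commutator L M n \<kappa> =
    L n (\<lambda>p. M (fst p) (\<lambda>q. \<kappa> (fst q, snd q + snd p))) - M n (\<lambda>p. L (fst p) (\<lambda>q. \<kappa> (fst q, snd q + snd p)))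
    + L n (\<lambda>p. branches_sum M (snd p) (\<lambda>D. \<kappa> (fst p, D))) - M n (\<lambda>p. branches_sum L (snd p) (\<lambda>D. \<kappa> (fst p, D)))"

text \<open>Peeling off one branch \<open>b\<close> leaves terms with both operations in
  \<open>b\<close>, with both in the rest, and mixed ones; the mixed ones cancel by
  \<open>lincomb_swap\<close>. The induction over trees will supply the assumption with
  \<open>K\<close> the local commutator.\<close>

lemma branches_sum_commutator:
  fixes L M :: "('i::finite, 'v::real_vector) local_op"
  assumes L: "is_local L" and M: "is_local M"
    and nodes: "\<And>e s \<kappa>. (e, s) \<in># B \<Longrightarrow> node_sum L s (\<lambda>t. node_sum M t \<kappa>) - node_sum M s (\<lambda>t. node_sum L t \<kappa>)
      = node_sum K s \<kappa>"
  shows "branches_sum L B (\<lambda>B'. branches_sum M B' \<kappa>) - branches_sum M B (\<lambda>B'. branches_sum L B' \<kappa>)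
      = branches_sum K B \<kappa>"
  using nodes
proof (induction B arbitrary: \<kappa>)
  case (add b B)
  have b: "branch_sum L b (\<lambda>b'. branch_sum M b' \<rho>) - branch_sum M b (\<lambda>b'. branch_sum L b' \<rho>)
    = branch_sum K b \<rho>" for \<rho>
    using add.prems[of "fst b" "snd b" "\<lambda>v. \<rho> (fst b, v)"] by (simp add: branch_sum_def)
  have ex: "branch_sum P b (\<lambda>b'. branches_sum Q B (\<lambda>B'. \<kappa> (add_mset b' B'))) =
    branches_sum Q B (\<lambda>B'. branch_sum P b (\<lambda>b'. \<kappa> (add_mset b' B')))"
    if "is_local P" "is_local Q" for P Q :: "('i, 'v) local_op"
    using lincomb_swap[OF branch_sum_lincomb[OF that(1)] branches_sum_lincomb[OF that(2)]] by fast
  have split: "branches_sum P (add_mset b B) (\<lambda>B'. branches_sum Q B' \<kappa>) =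
      branch_sum P b (\<lambda>b'. branch_sum Q b' (\<lambda>b''. \<kappa> (add_mset b'' B)))
      + branch_sum P b (\<lambda>b'. branches_sum Q B (\<lambda>B'. \<kappa> (add_mset b' B')))
      + branches_sum P B (\<lambda>B'. branch_sum Q b (\<lambda>b'. \<kappa> (add_mset b' B')))
      + branches_sum P B (\<lambda>B'. branches_sum Q B' (\<lambda>B''. \<kappa> (add_mset b B'')))"
    if "is_local P" for P Q :: "('i, 'v) local_op"
    unfolding branches_sum_add lincomb_fun_add[OF branch_sum_lincomb[OF that]]
      lincomb_fun_add[OF branches_sum_lincomb[OF that]]
    by (simp add: add.assoc)
  have "branches_sum L B (\<lambda>B'. branches_sum M B' (\<lambda>B''. \<kappa> (add_mset b B''))) -
      branches_sum M B (\<lambda>B'. branches_sum L B' (\<lambda>B''. \<kappa> (add_mset b B''))) =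
      branches_sum K B (\<lambda>B''. \<kappa> (add_mset b B''))"
    by (rule add.IH) (use add.prems in auto)
  then show ?case
    unfolding split[OF L] split[OF M] ex[OF L M] ex[OF M L] branches_sum_add[of K] b[symmetric]
    by (simp add: algebra_simps)
qed simp

text \<open>Operations at two different nodes commute unless one of the nodes was created by the other
  operation, so only contributions at a single node survive in the commutator: both operations applied
  at that node, or one of them applied inside the branches that the other has just added there.\<close>

theorem node_sum_commutator:
  fixes L M :: "('i::finite, 'v::real_vector) local_op"
  assumes L: "is_local L" and M: "is_local M"
  shows "node_sum L t (\<lambda>s. node_sum M s \<kappa>) - node_sum M t (\<lambda>s. node_sum L s \<kappa>)
    = node_sum (local_commutator L M) t \<kappa>"
proof (induction t arbitrary: \<kappa>)
  case (Node n B)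
  have br: "branches_sum L B (\<lambda>B'. branches_sum M B' \<rho>) - branches_sum M B (\<lambda>B'. branches_sum L B' \<rho>)
      = branches_sum (local_commutator L M) B \<rho>" for \<rho>
    by (rule branches_sum_commutator[OF L M], rule Node.IH) auto
  have ex: "P n (\<lambda>p. branches_sum Q B (\<lambda>B'. \<kappa> (Node (fst p) (snd p + B')))) =
    branches_sum Q B (\<lambda>B'. P n (\<lambda>p. \<kappa> (Node (fst p) (snd p + B'))))"
    if "is_local P" "is_local Q" for P Q :: "('i, 'v) local_op"
    by (rule lincomb_swap[of graftable "P n" UNIV "branches_sum Q B"])
      (use that branches_sum_lincomb in \<open>auto simp: is_local_def\<close>)
  \<comment> \<open>Five cases: if \<open>P\<close> acts at the root, then \<open>Q\<close> acts
    there, in a branch just added, or in an old branch; if \<open>P\<close> acts in a branch, then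
    \<open>Q\<close> acts at the root or in a branch.\<close>
  have split: "node_sum P (Node n B) (\<lambda>s. node_sum Q s \<kappa>) =
      P n (\<lambda>p. Q (fst p) (\<lambda>q. \<kappa> (Node (fst q) (snd q + snd p + B))))
      + P n (\<lambda>p. branches_sum Q (snd p) (\<lambda>D. \<kappa> (Node (fst p) (D + B))))
      + P n (\<lambda>p. branches_sum Q B (\<lambda>B'. \<kappa> (Node (fst p) (snd p + B'))))
      + branches_sum P B (\<lambda>B'. Q n (\<lambda>p. \<kappa> (Node (fst p) (snd p + B'))))
      + branches_sum P B (\<lambda>B'. branches_sum Q B' (\<lambda>B''. \<kappa> (Node n B'')))"
    if "is_local P" for P Q :: "('i, 'v) local_op"
  proof -
    have P: "lincomb graftable (P n)"
      using that by (simp add: is_local_def)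
    show ?thesis
      unfolding node_sum_Node at_root.simps branches_sum_union fst_conv snd_conv
        lincomb_fun_add[OF P] lincomb_fun_add[OF branches_sum_lincomb[OF that]]
      by (simp add: add.assoc)
  qed
  show ?case
    unfolding split[OF L] split[OF M] ex[OF L M] ex[OF M L] node_sum_Node[of "local_commutator L M"]
      br[symmetric] at_root.simps
    unfolding local_commutator_def by (simp add: algebra_simps)
qed


section \<open>Grafting and raising as local operations\<close>

lemma mi_binom_eq_0: "\<not> l \<le> n \<Longrightarrow> mi_binom n l = 0"
  by (auto simp: mi_binom_def less_eq_vec_def not_le)

text \<open>Both sides are the multinomial coefficient n! / (l! m! (n - l - m)!), and both vanish
  when l + m exceeds n, also with truncated subtraction.\<close>

lemma choose_mult_commute: "(n choose l) * ((n - l) choose m) = (n choose m) * ((n - m) choose l)"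
proof (cases "l + m \<le> n")
  case True
  then have "(n choose l) * ((n - l) choose m) = (n choose (l + m)) * ((l + m) choose l)"
    "(n choose m) * ((n - m) choose l) = (n choose (l + m)) * ((l + m) choose m)"
    using choose_mult[of l "l + m" n] choose_mult[of m "l + m" n] by auto
  then show ?thesis
    using binomial_symmetric[of l "l + m"] by simp
next
  case False
  then have "n choose l = 0 \<or> (n - l) choose m = 0" "n choose m = 0 \<or> (n - m) choose l = 0"
    by (auto simp: not_le)
  then show ?thesis
    by (metis mult_is_0)
qed

lemma mi_binom_mult_commute: "mi_binom n l * mi_binom (n - l) m = mi_binom n m * mi_binom (n - m) l"
  by (simp add: mi_binom_def choose_mult_commute flip: prod.distrib)

lemma axis_le_iff: "axis j 1 \<le> (l :: nat ^ 'i::finite) \<longleftrightarrow> 1 \<le> l $ j"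
  by (auto simp: less_eq_vec_def axis_def)

text \<open>Pascal's rule in the component \<open>j\<close>; the shift leaves all other factors
  unchanged.\<close>

lemma mi_binom_Suc:
  "mi_binom (n + axis j 1) l = mi_binom n l + (if axis j 1 \<le> l then mi_binom n (l - axis j 1) else 0)"
proof -
  have split: "mi_binom k m = (k $ j choose m $ j) * (\<Prod>i\<in>UNIV - {j}. k $ i choose m $ i)"
    for k m :: "nat ^ 'a"
    by (simp add: mi_binom_def prod.remove[of UNIV j])
  have "(\<Prod>i\<in>UNIV - {j}. (n + axis j 1) $ i choose l $ i) = (\<Prod>i\<in>UNIV - {j}. n $ i choose l $ i)"
    "(\<Prod>i\<in>UNIV - {j}. n $ i choose (l - axis j 1) $ i) = (\<Prod>i\<in>UNIV - {j}. n $ i choose l $ i)"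
    by (auto simp: axis_def intro!: prod.cong)
  then show ?thesis
    unfolding split axis_le_iff by (cases "l $ j") (auto simp: algebra_simps)
qed

lemma mi_size_add: "mi_size (l + m) = mi_size l + mi_size m"
  by (simp add: mi_size_def sum.distrib)

lemma mi_size_axis: "mi_size (axis j 1 :: nat ^ 'i::finite) = 1"
  by (simp add: mi_size_def axis_def)

lemma mi_size_eq_0: "mi_size l = 0 \<longleftrightarrow> l = 0"
  by (auto simp: mi_size_def vec_eq_iff)

text \<open>The coefficient of t^m in the action of I_a(s) at a node with decoration
  \<open>n\<close>.\<close>

definition graft :: "nat \<Rightarrow> nat ^ 'i \<Rightarrow> 'i tree \<Rightarrow> ('i::finite, 'v::real_vector) local_op" where
  "graft m a s n \<kappa> = (\<Sum>l | mi_size l = m.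
     if l \<le> a \<and> l \<le> n then real (mi_binom n l) *\<^sub>R \<kappa> (n - l, {#((I_edge, a - l), s)#}) else 0)"

definition raise_dec :: "'i \<Rightarrow> ('i::finite, 'v::real_vector) local_op" where
  "raise_dec j n \<kappa> = \<kappa> (n + axis j 1, {#})"

text \<open>Where \<open>l\<close> does not lie below \<open>n\<close> the binomial vanishes, so the
  guard on \<open>n\<close> can go. The index set then no longer depends on the decoration, and sums
  at different decorations can be compared.\<close>

lemma graft_eq:
  "graft m a s n \<kappa> = (\<Sum>l | mi_size l = m \<and> l \<le> a.
     real (mi_binom n l) *\<^sub>R \<kappa> (n - l, {#((I_edge, a - l), s)#}))"
proof -
  have "finite {l. mi_size l = m \<and> l \<le> a}"
    by (rule finite_subset[OF _ finite_mi_size[of m]]) auto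
  then show ?thesis
    unfolding graft_def
    by (intro sum.mono_neutral_cong_right finite_mi_size) (auto simp: mi_binom_eq_0)
qed

lemma graft_lincomb: "decorated s \<Longrightarrow> lincomb graftable (graft m a s n)"
  unfolding graft_eq by (intro lincomb_sum lincomb_scale lincomb_eval) (simp add: graftable_def)

lemma is_local_graft: "decorated s \<Longrightarrow> is_local (graft m a s)"
  by (simp add: is_local_def graft_lincomb)

lemma is_local_raise_dec: "is_local (raise_dec j)"
  unfolding is_local_def raise_dec_def by (auto intro!: lincomb_eval simp: graftable_def)

text \<open>Grafting adds the single branch \<open>s\<close>, so acting inside the added branches
  means acting on \<open>s\<close> before it is grafted. This produces the terms in which a product
  of two generators acts.\<close>

lemma graft_branches_sum:
  assumes "is_local M"
  shows "graft m a s n (\<lambda>p. branches_sum M (snd p) (\<lambda>D. \<kappa> (fst p, D))) =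
    node_sum M s (\<lambda>v. graft m a v n \<kappa>)"
proof -
  note [simp] = lincomb_fun_sum[OF node_sum_lincomb[OF assms]] lincomb_fun_scale[OF node_sum_lincomb[OF assms]]
  show ?thesis
    unfolding graft_eq by (simp add: branches_sum_add branch_sum_def)
qed

text \<open>The coefficients agree by \<open>mi_binom_mult_commute\<close>, the decorations because
  n - l - l' is symmetric in l and l', and the branches because they form a multiset.\<close>

lemma graft_commute:
  fixes n :: "nat ^ 'i::finite"
  shows "graft m a s n (\<lambda>p. graft k b r (fst p) (\<lambda>q. \<kappa> (fst q, snd q + snd p))) =
    graft k b r n (\<lambda>p. graft m a s (fst p) (\<lambda>q. \<kappa> (fst q, snd q + snd p)))"
proof -
  have "real (mi_binom n l) * real (mi_binom (n - l) l') = real (mi_binom n l') * real (mi_binom (n - l') l)"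
    for l l'
    by (simp only: mi_binom_mult_commute flip: of_nat_mult)
  moreover have "n - l - l' = n - l' - l" for l l' :: "nat ^ 'i"
    by (simp add: vec_eq_iff add.commute)
  ultimately show ?thesis
    unfolding graft_eq scaleR_sum_right by (subst sum.swap) (simp add: add_mset_commute)
qed

text \<open>Raising first replaces (n choose l) by (n + e_j choose l). In Pascal's rule the first
  summand gives the opposite order of operations; the second, after shifting l by e_j, gives
  grafting of order m - 1 along a - e_j.\<close>

lemma graft_raise_dec:
  "raise_dec j n (\<lambda>p. graft m a s (fst p) (\<lambda>q. \<kappa> (fst q, snd q + snd p))) =
    graft m a s n (\<lambda>p. raise_dec j (fst p) (\<lambda>q. \<kappa> (fst q, snd q + snd p))) +
    (if 0 < m \<and> axis j 1 \<le> a then graft (m - 1) (a - axis j 1) s n \<kappa> else 0)"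
proof -
  let ?e = "axis j 1"
  let ?F = "\<lambda>l. \<kappa> (n + ?e - l, {#((I_edge, a - l), s)#})"
  have "raise_dec j n (\<lambda>p. graft m a s (fst p) (\<lambda>q. \<kappa> (fst q, snd q + snd p))) =
    (\<Sum>l | mi_size l = m \<and> l \<le> a. real (mi_binom (n + ?e) l) *\<^sub>R ?F l)"
    by (simp add: raise_dec_def graft_eq)
  moreover have "\<dots> = (\<Sum>l | mi_size l = m \<and> l \<le> a. real (mi_binom n l) *\<^sub>R ?F l) +
    (\<Sum>l | mi_size l = m \<and> l \<le> a. if ?e \<le> l then real (mi_binom n (l - ?e)) *\<^sub>R ?F l else 0)"
    unfolding mi_binom_Suc sum.distrib[symmetric] by (intro sum.cong) (auto simp: scaleR_add_left)
  moreover have "(\<Sum>l | mi_size l = m \<and> l \<le> a. real (mi_binom n l) *\<^sub>R ?F l) =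
    graft m a s n (\<lambda>p. raise_dec j (fst p) (\<lambda>q. \<kappa> (fst q, snd q + snd p)))"
  proof -
    \<comment> \<open>Under truncated subtraction, n + e_j - l and n - l + e_j need agree only for l
      below n; otherwise the coefficient is 0.\<close>
    have "real (mi_binom n l) *\<^sub>R ?F l = real (mi_binom n l) *\<^sub>R \<kappa> (n - l + ?e, {#((I_edge, a - l), s)#})" for l
    proof (cases "l \<le> n")
      case True
      then have "n + ?e - l = n - l + ?e"
        by (simp add: vec_eq_iff less_eq_vec_def)
      then show ?thesis by simp
    qed (simp add: mi_binom_eq_0)
    then show ?thesis
      by (simp add: raise_dec_def graft_eq del: scaleR_cancel_left)
  qed
  moreover have "(\<Sum>l | mi_size l = m \<and> l \<le> a. if ?e \<le> l then real (mi_binom n (l - ?e)) *\<^sub>R ?F l else 0) =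
    (if 0 < m \<and> ?e \<le> a then graft (m - 1) (a - ?e) s n \<kappa> else 0)"
  proof -
    have fin: "finite {l. mi_size l = m \<and> l \<le> a}"
      by (rule finite_subset[OF _ finite_mi_size[of m]]) auto
    have "(\<Sum>l | mi_size l = m \<and> l \<le> a. if ?e \<le> l then real (mi_binom n (l - ?e)) *\<^sub>R ?F l else 0) =
      (\<Sum>l | mi_size l = m \<and> l \<le> a \<and> ?e \<le> l. real (mi_binom n (l - ?e)) *\<^sub>R ?F l)"
      using fin by (simp add: sum.inter_filter[symmetric] conj_assoc)
    \<comment> \<open>Where the right side is 0 no index remains: such an l has positive size and
      lies between e_j and a.\<close>
    moreover have "{l. mi_size l = m \<and> l \<le> a \<and> ?e \<le> l} = {}" if "\<not> (0 < m \<and> ?e \<le> a)"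
    proof -
      have "0 < m \<and> ?e \<le> a" if l: "mi_size l = m" "l \<le> a" "?e \<le> l" for l
      proof
        have "l \<noteq> 0"
          using l(3) unfolding axis_le_iff by auto
        then show "0 < m"
          using l(1) mi_size_eq_0[of l] by simp
        show "?e \<le> a"
          using l(2,3) by (rule order.trans[rotated])
      qed
      then show ?thesis
        using that by blast
    qed
    moreover have "(\<Sum>l | mi_size l = m \<and> l \<le> a \<and> ?e \<le> l. real (mi_binom n (l - ?e)) *\<^sub>R ?F l) =
      graft (m - 1) (a - ?e) s n \<kappa>" if m: "0 < m" and e: "?e \<le> a"
      unfolding graft_eq
    proof (rule sum.reindex_bij_witness[of _ "\<lambda>l. l + ?e" "\<lambda>l. l - ?e"])
      fix l assume l: "l \<in> {l. mi_size l = m \<and> l \<le> a \<and> ?e \<le> l}"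
      then show eq: "l - ?e + ?e = l"
        by (simp add: vec_eq_iff less_eq_vec_def)
      have "mi_size (l - ?e) + 1 = m"
        using l mi_size_add[of "l - ?e" ?e] unfolding eq mi_size_axis by simp
      then show "l - ?e \<in> {l. mi_size l = m - 1 \<and> l \<le> a - ?e}"
        using l by (auto simp: less_eq_vec_def intro: diff_le_mono)
      have "n + ?e - l = n - (l - ?e)" "a - l = a - ?e - (l - ?e)"
        using l by (auto simp: vec_eq_iff less_eq_vec_def)
      then show "real (mi_binom n (l - ?e)) *\<^sub>R \<kappa> (n - (l - ?e), {#((I_edge, a - ?e - (l - ?e)), s)#}) =
          real (mi_binom n (l - ?e)) *\<^sub>R ?F l"
        by simp
    next
      fix l assume l: "l \<in> {l. mi_size l = m - 1 \<and> l \<le> a - ?e}"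
      show "l + ?e - ?e = l"
        by (simp add: vec_eq_iff)
      have "l $ i + ?e $ i \<le> a $ i" for i
        using l e le_diff_conv2[of "?e $ i" "a $ i" "l $ i"] by (auto simp: less_eq_vec_def)
      then have "l + ?e \<le> a" "?e \<le> l + ?e"
        by (simp_all add: less_eq_vec_def)
      moreover have "mi_size (l + ?e) = m"
        unfolding mi_size_add mi_size_axis using l m by simp
      ultimately show "l + ?e \<in> {l. mi_size l = m \<and> l \<le> a \<and> ?e \<le> l}"
        by blast
    qed
    ultimately show ?thesis by auto
  qed
  ultimately show ?thesis by (simp only:)
qed

text \<open>The two graftings commute at one node, so only the terms inside a newly grafted tree
  remain.\<close>

lemma local_commutator_graft_graft:
  assumes "decorated s" "decorated r"
  shows "local_commutator (graft m a s) (graft k b r) n \<kappa> =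
    node_sum (graft k b r) s (\<lambda>v. graft m a v n \<kappa>) - node_sum (graft m a s) r (\<lambda>v. graft k b v n \<kappa>)"
  unfolding local_commutator_def graft_commute[of m a s n k b r]
  by (simp add: graft_branches_sum is_local_graft assms)

text \<open>Raising adds no branch, so the only nested term is the raising inside the grafted tree;
  the other term is the defect from \<open>graft_raise_dec\<close>.\<close>

lemma local_commutator_raise_graft:
  assumes "decorated s"
  shows "local_commutator (raise_dec j) (graft m a s) n \<kappa> =
    (if 0 < m \<and> axis j 1 \<le> a then graft (m - 1) (a - axis j 1) s n \<kappa> else 0)
    - node_sum (raise_dec j) s (\<lambda>v. graft m a v n \<kappa>)"
  unfolding local_commutator_def graft_raise_dec
  by (simp add: graft_branches_sum is_local_raise_dec, simp add: raise_dec_def)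

lemma local_commutator_swap: "local_commutator L M n \<kappa> = - local_commutator M L n \<kappa>"
  by (simp add: local_commutator_def)

lemma local_commutator_raise_raise: "local_commutator (raise_dec j) (raise_dec k) n \<kappa> = 0"
  by (simp add: local_commutator_def raise_dec_def ac_simps)


section \<open>Bilinear extension\<close>

lemma lookup_scaleR: "Poly_Mapping.lookup (c *\<^sub>R x) g = c * Poly_Mapping.lookup (x :: ('g, real) poly_mapping) g"
proof -
  have "finite {i. c * Poly_Mapping.lookup x i \<noteq> 0}"
    by (rule finite_subset[OF _ finite_lookup[of x]]) auto
  then show ?thesis
    by (simp add: scaleR_poly_mapping_def)
qed

lemma linear_lookup: "linear (\<lambda>x :: ('g, real) poly_mapping. Poly_Mapping.lookup x g)"
  by (rule linearI) (simp_all add: lookup_add lookup_scaleR)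

lemma keys_scaleR: "Poly_Mapping.keys (c *\<^sub>R x) \<subseteq> Poly_Mapping.keys (x :: ('g, real) poly_mapping)"
  by (auto simp: in_keys_iff lookup_scaleR)

lemma V_expand: "x = (\<Sum>g \<in> Poly_Mapping.keys x. Poly_Mapping.lookup x g *\<^sub>R basis_vec g)"
proof (rule poly_mapping_eqI)
  fix h
  have "Poly_Mapping.lookup (\<Sum>g \<in> Poly_Mapping.keys x. Poly_Mapping.lookup x g *\<^sub>R basis_vec g) h =
      (\<Sum>g \<in> Poly_Mapping.keys x. if g = h then Poly_Mapping.lookup x h else 0)"
    unfolding linear_sum[OF linear_lookup]
    by (intro sum.cong) (auto simp: lookup_scaleR basis_vec_def lookup_single when_def)
  then show "Poly_Mapping.lookup x h =
      Poly_Mapping.lookup (\<Sum>g \<in> Poly_Mapping.keys x. Poly_Mapping.lookup x g *\<^sub>R basis_vec g) h"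
    by (simp add: in_keys_iff)
qed

lemma linear_eq_basis:
  assumes "linear f" "linear g" "\<And>b. f (basis_vec b) = g (basis_vec b)"
  shows "f x = g x"
  using assms by (subst (1 2) V_expand[of x]) (simp add: linear_sum linear_scale)

text \<open>The range of summation varies with x. On a common finite superset of the keys, where the
  extra coefficients vanish, linearity is termwise.\<close>

lemma linear_finite_sum_keys:
  fixes f :: "'g \<Rightarrow> 'v::real_vector"
  shows "linear (\<lambda>x. \<Sum>g \<in> Poly_Mapping.keys x. Poly_Mapping.lookup x g *\<^sub>R f g)"
proof -
  have eq: "(\<Sum>g \<in> Poly_Mapping.keys x. Poly_Mapping.lookup x g *\<^sub>R f g) =
    (\<Sum>g \<in> A. Poly_Mapping.lookup x g *\<^sub>R f g)"
    if "finite A" "Poly_Mapping.keys x \<subseteq> A" for A and x :: "('g, real) poly_mapping"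
    by (rule sum.mono_neutral_left) (use that in \<open>auto simp: in_keys_iff\<close>)
  show ?thesis
  proof (rule linearI)
    fix x y :: "('g, real) poly_mapping" and c
    let ?A = "Poly_Mapping.keys x \<union> Poly_Mapping.keys y"
    show "(\<Sum>g\<in>Poly_Mapping.keys (x + y). Poly_Mapping.lookup (x + y) g *\<^sub>R f g) =
      (\<Sum>g\<in>Poly_Mapping.keys x. Poly_Mapping.lookup x g *\<^sub>R f g) +
      (\<Sum>g\<in>Poly_Mapping.keys y. Poly_Mapping.lookup y g *\<^sub>R f g)"
      using keys_add[of x y]
      by (subst (1 2 3) eq[of ?A]) (simp_all add: lookup_add scaleR_add_left sum.distrib)
    show "(\<Sum>g\<in>Poly_Mapping.keys (c *\<^sub>R x). Poly_Mapping.lookup (c *\<^sub>R x) g *\<^sub>R f g) =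
      c *\<^sub>R (\<Sum>g\<in>Poly_Mapping.keys x. Poly_Mapping.lookup x g *\<^sub>R f g)"
      using keys_scaleR[of c x]
      by (subst eq[of "Poly_Mapping.keys x"]) (simp_all add: lookup_scaleR scaleR_sum_right)
  qed
qed

lemma bilinear_bilinear_ext: "bilinear (bilinear_ext f)"
proof -
  have "bilinear_ext f x = (\<lambda>y. \<Sum>h \<in> Poly_Mapping.keys y. Poly_Mapping.lookup y h *\<^sub>R
      (\<Sum>g \<in> Poly_Mapping.keys x. Poly_Mapping.lookup x g *\<^sub>R f g h))" for x
    unfolding bilinear_ext_def by (subst sum.swap) (simp add: scaleR_sum_right mult.commute)
  moreover have "(\<lambda>x. bilinear_ext f x y) = (\<lambda>x. \<Sum>g \<in> Poly_Mapping.keys x. Poly_Mapping.lookup x g *\<^sub>R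
      (\<Sum>h \<in> Poly_Mapping.keys y. Poly_Mapping.lookup y h *\<^sub>R f g h))" for y
    unfolding bilinear_ext_def by (simp add: scaleR_sum_right)
  ultimately show ?thesis
    unfolding bilinear_def by (simp only: linear_finite_sum_keys simp_thms)
qed

lemma bilinear_ext_basis: "bilinear_ext f (basis_vec g) (basis_vec h) = f g h"
  by (simp add: bilinear_ext_def basis_vec_def)

lemma bilinear_zero: "bilinear (\<lambda>_ _. 0)"
  by (simp add: bilinear_def module_hom_zero linear_zero)

lemma bilinear_pi_coeff: "bilinear (pi_coeff m)"
  by (simp add: pi_coeff_def bilinear_bilinear_ext bilinear_zero)

lemma bilinear_omega_coeff: "bilinear (omega_coeff m)"
  by (simp add: omega_coeff_def prelie_def bilinear_bilinear_ext)

lemma linear_pi_coeff: "linear (pi_coeff m x)" "linear (\<lambda>x. pi_coeff m x y)"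
  using bilinear_pi_coeff by (auto simp: bilinear_def)

lemma linear_omega_coeff: "linear (omega_coeff m x)" "linear (\<lambda>x. omega_coeff m x y)"
  using bilinear_omega_coeff by (auto simp: bilinear_def)

lemma trilinear_eq_basis:
  fixes F G :: "('i::finite) V \<Rightarrow> 'i V \<Rightarrow> 'i V \<Rightarrow> 'i V"
  assumes "\<And>y z. linear (\<lambda>x. F x y z)" "\<And>x z. linear (\<lambda>y. F x y z)" "\<And>x y. linear (\<lambda>z. F x y z)"
    and "\<And>y z. linear (\<lambda>x. G x y z)" "\<And>x z. linear (\<lambda>y. G x y z)" "\<And>x y. linear (\<lambda>z. G x y z)"
    and eq: "\<And>g h k. F (basis_vec g) (basis_vec h) (basis_vec k) = G (basis_vec g) (basis_vec h) (basis_vec k)"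
  shows "F x y z = G x y z"
proof -
  have 1: "F (basis_vec g) (basis_vec h) z = G (basis_vec g) (basis_vec h) z" for g h z
    by (rule linear_eq_basis[OF assms(3,6) eq])
  have 2: "F (basis_vec g) y z = G (basis_vec g) y z" for g y z
    by (rule linear_eq_basis[OF assms(2,5) 1])
  show ?thesis
    by (rule linear_eq_basis[OF assms(1,4) 2])
qed

lemmas linear_comp = linear_compose[unfolded o_def]

lemmas linear_coeff = linear_compose_add linear_compose_sub linear_compose_sum linear_pi_coeff linear_omega_coeff
  linear_comp[OF _ linear_pi_coeff(1)] linear_comp[OF _ linear_pi_coeff(2)]
  linear_comp[OF _ linear_omega_coeff(1)] linear_comp[OF _ linear_omega_coeff(2)]


section \<open>The operations on basis elements as node sums\<close>

text \<open>I_a(v) for a raw tree v, so that it can serve as the function \<kappa> of a node sum; it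
  has this meaning only for decorated v.\<close>

definition planted :: "nat ^ 'i \<Rightarrow> ('i::finite) tree \<Rightarrow> 'i V" where
  "planted a v = basis_vec (Planted a (dtree_of v))"

text \<open>The local operation behind the coefficient of t^m in omega_t(g, -); a monomial X_j
  contributes in order 0 only.\<close>

fun gen_op :: "nat \<Rightarrow> ('i::finite) gen \<Rightarrow> ('i, 'v::real_vector) local_op" where
  "gen_op m (Planted a \<sigma>) = graft m a (tree_of \<sigma>)"
| "gen_op m (X j) = (if m = 0 then raise_dec j else (\<lambda>_ _. 0))"

lemma decorated_tree_of [simp]: "decorated (tree_of t)"
  using tree_of[of t] by simp

lemma tree_of_dtree_of: "decorated t \<Longrightarrow> tree_of (dtree_of t) = t"
  by (simp add: dtree_of_inverse)

lemma is_local_gen_op: "is_local (gen_op m g)"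
  by (cases g) (auto simp: is_local_graft is_local_raise_dec, auto simp: is_local_def lincomb_zero)

lemma at_root_zero [simp]: "at_root (\<lambda>_ _. 0) u \<kappa> = 0"
  by (cases u) simp

lemma node_sum_zero [simp]: "node_sum (\<lambda>_ _. 0) t \<kappa> = 0"
  by (simp add: node_sum_def split_def)

lemma at_root_graft:
  "at_root (graft m a s) u \<kappa> = (\<Sum>l | mi_size l = m. if l \<le> a \<and> l \<le> root_dec u
     then real (mi_binom (root_dec u) l) *\<^sub>R \<kappa> (attach (a - l) s (map_root_dec (\<lambda>n. n - l) u)) else 0)"
  by (cases u) (auto simp: graft_def intro!: sum.cong)

text \<open>In order 0 only l = 0 occurs, with binomial 1, which leaves plain grafting.\<close>

lemma at_root_graft_0:
  fixes a :: "nat ^ 'i::finite"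
  shows "at_root (graft 0 a s) u \<kappa> = \<kappa> (attach a s u)"
proof -
  have "{l :: nat ^ 'i. mi_size l = 0} = {0}"
    by (auto simp: mi_size_eq_0)
  moreover have "(0 :: nat ^ 'i) \<le> n" "mi_binom n 0 = 1" for n
    by (simp_all add: less_eq_vec_def mi_binom_def)
  moreover have "map_root_dec (\<lambda>n. n) u = u"
    by (cases u) simp
  ultimately show ?thesis
    unfolding at_root_graft by simp
qed

lemma at_root_raise_dec: "at_root (raise_dec j) u \<kappa> = \<kappa> (map_root_dec (\<lambda>n. n + axis j 1) u)"
  by (cases u) (simp add: raise_dec_def)

text \<open>By \<open>at_root_graft_0\<close> the separate definition for m = 0 fits the general
  formula, so all powers of t are treated alike from here on.\<close>

lemma omega_coeff_basis:
  "omega_coeff m (basis_vec g) (basis_vec (Planted b \<tau>)) = node_sum (gen_op m g) (tree_of \<tau>) (planted b)"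
  "omega_coeff m (basis_vec g) (basis_vec (X j)) = 0"
proof -
  show "omega_coeff m (basis_vec g) (basis_vec (Planted b \<tau>)) = node_sum (gen_op m g) (tree_of \<tau>) (planted b)"
  proof (cases g)
    case (Planted a \<sigma>)
    then show ?thesis
      by (cases "m = 0", simp_all add: omega_coeff_def prelie_def bilinear_ext_basis node_sum_def planted_def)
        (simp_all add: at_root_graft_0, simp add: at_root_graft)
  next
    case (X j)
    then show ?thesis
      by (cases "m = 0") (simp_all add: omega_coeff_def prelie_def bilinear_ext_basis node_sum_def
          at_root_raise_dec planted_def)
  qed
  show "omega_coeff m (basis_vec g) (basis_vec (X j)) = 0"
    by (cases g; cases "m = 0"; simp add: omega_coeff_def prelie_def bilinear_ext_basis)
qed

lemma omega_coeff_planted: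
  "decorated t \<Longrightarrow> omega_coeff m (basis_vec g) (planted b t) = node_sum (gen_op m g) t (planted b)"
  unfolding planted_def[of b t] omega_coeff_basis tree_of_dtree_of ..

lemma pi_coeff_eq: "pi_coeff m x y = (if m = 1 then bilinear_ext pi1_gen x y else 0)"
  by (simp add: pi_coeff_def)

text \<open>Comparing with \<kappa>' on decorated trees suffices because every tree produced is
  decorated.\<close>

lemma linear_of_node_sum:
  assumes "linear f" "is_local L" "decorated t" "\<And>v. decorated v \<Longrightarrow> f (\<kappa> v) = \<kappa>' v"
  shows "f (node_sum L t \<kappa>) = node_sum L t \<kappa>'"
  using lincomb_linear[OF node_sum_lincomb_decorated[OF assms(2,3)] assms(1)]
    lincomb_cong[OF node_sum_lincomb_decorated[OF assms(2,3)], of "\<lambda>x. f (\<kappa> x)" \<kappa>'] assms(4)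
  by simp

lemma lincomb_fun_sum_mset: "lincomb S \<Phi> \<Longrightarrow> \<Phi> (\<lambda>x. \<Sum>i\<in>#A. f i x) = (\<Sum>i\<in>#A. \<Phi> (f i))"
proof (induction A)
  case (add i A)
  then show ?case
    using lincomb_fun_add[of S \<Phi> "f i" "\<lambda>x. \<Sum>i\<in>#A. f i x"] by simp
qed (auto simp: lincomb_fun_zero)

text \<open>For products whose left factor is itself a sum of planted trees: the sum over the trees
  to be grafted is absorbed into one local operation.\<close>

lemma node_sum_lincomb_param:
  assumes "lincomb S \<Phi>"
  shows "\<Phi> (\<lambda>v. node_sum (L v) t \<kappa>) = node_sum (\<lambda>n \<rho>. \<Phi> (\<lambda>v. L v n \<rho>)) t \<kappa>"
proof -
  have "\<Phi> (\<lambda>v. at_root (L v) u \<rho>) = at_root (\<lambda>n \<rho>. \<Phi> (\<lambda>v. L v n \<rho>)) u \<rho>" for u \<rho>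
    by (cases u) simp
  then show ?thesis
    unfolding node_sum_def split_def lincomb_fun_sum_mset[OF assms] by simp
qed

text \<open>The local operation of omega_i(omega_m(g, h), -): \<open>g\<close> acts inside the tree
  of \<open>h\<close> and the result is grafted. It is 0 for h = X_j since omega_m(g, X_j) =
  0.\<close>

fun nested_op :: "nat \<Rightarrow> nat \<Rightarrow> ('i::finite) gen \<Rightarrow> 'i gen \<Rightarrow> ('i, 'v::real_vector) local_op" where
  "nested_op i m g (Planted b \<rho>) = (\<lambda>n \<kappa>. node_sum (gen_op m g) (tree_of \<rho>) (\<lambda>v. graft i b v n \<kappa>))"
| "nested_op i m g (X j) = (\<lambda>_ _. 0)"

text \<open>The inner factor \<open>h\<close> acts on the tree first, so the node sums appear in the
  order opposite to the products.\<close>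

lemma omega_omega_right:
  "omega_coeff i (basis_vec g) (omega_coeff m (basis_vec h) (basis_vec (Planted c \<tau>))) =
    node_sum (gen_op m h) (tree_of \<tau>) (\<lambda>t. node_sum (gen_op i g) t (planted c))"
  unfolding omega_coeff_basis
  by (rule linear_of_node_sum[OF linear_omega_coeff(1) is_local_gen_op decorated_tree_of omega_coeff_planted])

lemma omega_omega_left:
  "omega_coeff i (omega_coeff m (basis_vec g) (basis_vec h)) (basis_vec (Planted c \<tau>)) =
    node_sum (nested_op i m g h) (tree_of \<tau>) (planted c)"
proof (cases h)
  case (Planted b \<rho>)
  have "omega_coeff i (planted b v) (basis_vec (Planted c \<tau>)) = node_sum (graft i b v) (tree_of \<tau>) (planted c)"
    if "decorated v" for v
    using omega_coeff_basis(1)[of i "Planted b (dtree_of v)" c \<tau>] that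
    by (simp add: planted_def[of b] tree_of_dtree_of)
  then have "omega_coeff i (omega_coeff m (basis_vec g) (basis_vec h)) (basis_vec (Planted c \<tau>)) =
      node_sum (gen_op m g) (tree_of \<rho>) (\<lambda>v. node_sum (graft i b v) (tree_of \<tau>) (planted c))"
    unfolding Planted omega_coeff_basis
    by (intro linear_of_node_sum[OF linear_omega_coeff(2) is_local_gen_op decorated_tree_of])
  also have "\<dots> = node_sum (nested_op i m g h) (tree_of \<tau>) (planted c)"
    unfolding Planted nested_op.simps
    by (rule node_sum_lincomb_param[OF node_sum_lincomb[OF is_local_gen_op]])
  finally show ?thesis .
qed (simp add: omega_coeff_basis linear_0[OF linear_omega_coeff(2)])

text \<open>The local operation of omega_i(pi_1(g, h), -).\<close>

fun bracket_op :: "nat \<Rightarrow> ('i::finite) gen \<Rightarrow> 'i gen \<Rightarrow> ('i, 'v::real_vector) local_op" where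
  "bracket_op i (Planted a \<sigma>) (X j) =
    (if axis j 1 \<le> a then graft i (a - axis j 1) (tree_of \<sigma>) else (\<lambda>_ _. 0))"
| "bracket_op i (X j) (Planted a \<sigma>) =
    (if axis j 1 \<le> a then (\<lambda>n \<kappa>. - graft i (a - axis j 1) (tree_of \<sigma>) n \<kappa>) else (\<lambda>_ _. 0))"
| "bracket_op i (Planted a \<sigma>) (Planted b \<tau>) = (\<lambda>_ _. 0)"
| "bracket_op i (X j) (X k) = (\<lambda>_ _. 0)"

lemma node_sum_scale:
  fixes L :: "('a::finite, 'b::real_vector) local_op"
  shows "node_sum (\<lambda>n \<kappa>. c *\<^sub>R L n \<kappa>) t \<kappa> = c *\<^sub>R node_sum L t \<kappa>"
proof -
  have "at_root (\<lambda>n \<kappa>. c *\<^sub>R L n \<kappa>) u \<kappa> = c *\<^sub>R at_root L u \<kappa>" for u \<kappa>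
    by (cases u) simp
  moreover have "(\<Sum>x\<in>#A. c *\<^sub>R f x) = c *\<^sub>R (\<Sum>x\<in>#A. f x)" for A and f :: "'c \<Rightarrow> 'b"
    by (induction A) (auto simp: scaleR_add_right)
  ultimately show ?thesis
    by (simp add: node_sum_def split_def)
qed

lemma node_sum_add: "node_sum (\<lambda>n \<kappa>. L n \<kappa> + M n \<kappa>) t \<kappa> = node_sum L t \<kappa> + node_sum M t \<kappa>"
proof -
  have "at_root (\<lambda>n \<kappa>. L n \<kappa> + M n \<kappa>) u \<kappa> = at_root L u \<kappa> + at_root M u \<kappa>" for u \<kappa>
    by (cases u) simp
  then show ?thesis
    by (simp add: node_sum_def split_def sum_mset.distrib)
qed

lemma node_sum_uminus: "node_sum (\<lambda>n \<kappa>. - L n \<kappa>) t \<kappa> = - node_sum L t \<kappa>"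
  using node_sum_scale[of "-1" L] by simp

lemma node_sum_diff: "node_sum (\<lambda>n \<kappa>. L n \<kappa> - M n \<kappa>) t \<kappa> = node_sum L t \<kappa> - node_sum M t \<kappa>"
  using node_sum_add[of L "\<lambda>n \<kappa>. - M n \<kappa>"] by (simp add: node_sum_uminus)

lemma omega_pi_left:
  "omega_coeff i (pi_coeff m (basis_vec g) (basis_vec h)) (basis_vec (Planted c \<tau>)) =
    (if m = 1 then node_sum (bracket_op i g h) (tree_of \<tau>) (planted c) else 0)"
  by (cases g; cases h)
    (simp_all add: pi_coeff_eq bilinear_ext_basis lower_I_def omega_coeff_basis node_sum_uminus
      linear_0[OF linear_omega_coeff(2)] linear_neg[OF linear_omega_coeff(2)])

lemma branch_sum_zero_op [simp]: "branch_sum (\<lambda>_ _. 0) b \<kappa> = 0"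
  by (simp add: branch_sum_def)

lemma branches_sum_zero_op [simp]: "branches_sum (\<lambda>_ _. 0) B \<kappa> = 0"
  by (simp add: branches_sum_def)

lemma local_commutator_zero:
  assumes "is_local M"
  shows "local_commutator (\<lambda>_ _. 0) M n \<kappa> = 0" "local_commutator M (\<lambda>_ _. 0) n \<kappa> = 0"
proof -
  have "lincomb graftable (M n)"
    using assms by (simp add: is_local_def)
  then show "local_commutator (\<lambda>_ _. 0) M n \<kappa> = 0" "local_commutator M (\<lambda>_ _. 0) n \<kappa> = 0"
    by (simp_all add: local_commutator_def lincomb_fun_zero)
qed

text \<open>Only a planted tree paired with a monomial has a defect, of order one less because pi_t
  carries one power of t. A monomial acts in order 0 only, so the case distinction tests the index
  that belongs to it.\<close>

lemma local_commutator_gen_op: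
  "local_commutator (gen_op p h) (gen_op q g) n \<kappa> =
    (if (case g of X _ \<Rightarrow> q | Planted _ _ \<Rightarrow> p) = 0 \<and> 0 < p + q then bracket_op (p + q - 1) g h n \<kappa> else 0)
    + nested_op p q g h n \<kappa> - nested_op q p h g n \<kappa>"
proof (cases g; cases h)
  fix a \<sigma> b \<rho> assume "g = Planted a \<sigma>" "h = Planted b \<rho>"
  then show ?thesis
    by (simp add: local_commutator_graft_graft)
next
  fix a \<sigma> j assume "g = Planted a \<sigma>" "h = X j"
  then show ?thesis
    by (auto simp: local_commutator_raise_graft local_commutator_zero is_local_graft)
next
  fix j b \<rho> assume "g = X j" "h = Planted b \<rho>"
  then show ?thesis
    by (auto simp: local_commutator_swap[of "graft _ b (tree_of \<rho>)" "raise_dec j"]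
        local_commutator_raise_graft local_commutator_zero is_local_graft)
next
  fix j k assume "g = X j" "h = X k"
  then show ?thesis
    by (simp add: local_commutator_raise_raise local_commutator_zero is_local_raise_dec
        local_commutator_zero[of "\<lambda>_ _. 0"] is_local_gen_op[of "Suc 0" "X j", simplified])
qed

section \<open>The post-Lie identity on basis elements\<close>

lemma sum_le_reverse: "(\<Sum>i\<le>n::nat. f i (n - i)) = (\<Sum>i\<le>n. f (n - i) i)"
  by (rule sum.reindex_bij_witness[of _ "\<lambda>i. n - i" "\<lambda>i. n - i"]) auto

text \<open>The bracket lives in degree one only, so among all splittings of n a single term
  survives, and none for n = 0.\<close>

lemma sum_le_single:
  "(\<Sum>i\<le>n::nat. if n - i = 1 then f i else 0) = (if 0 < n then f (n - 1) else 0)"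
  "(\<Sum>i\<le>n::nat. if i = 1 then f i else 0) = (if 0 < n then f 1 else 0)"
proof -
  \<comment> \<open>For n = 0 the truncated n - 1 is 0 and equals i, hence the inner test.\<close>
  have "(\<Sum>i\<le>n. if n - i = 1 then f i else 0) = (\<Sum>i\<le>n. if i = n - 1 then (if 0 < n then f i else 0) else 0)"
    by (intro sum.cong) auto
  then show "(\<Sum>i\<le>n. if n - i = 1 then f i else 0) = (if 0 < n then f (n - 1) else 0)"
    by simp
qed auto

lemma node_sum_if: "node_sum (\<lambda>n \<kappa>. if c then L n \<kappa> else 0) t \<kappa> = (if c then node_sum L t \<kappa> else 0)"
  by simp

lemma node_sum_commutator_gen_op:
  fixes \<kappa> :: "('i::finite) tree \<Rightarrow> 'v::real_vector"
  assumes "p + q = m"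
  shows "node_sum (gen_op p h) t (\<lambda>s. node_sum (gen_op q g) s \<kappa>)
      - node_sum (gen_op q g) t (\<lambda>s. node_sum (gen_op p h) s \<kappa>) =
    (if (case g of X _ \<Rightarrow> q | Planted _ _ \<Rightarrow> p) = 0 \<and> 0 < m then node_sum (bracket_op (m - 1) g h) t \<kappa> else 0)
    + node_sum (nested_op p q g h) t \<kappa> - node_sum (nested_op q p h g) t \<kappa>"
proof -
  have "(local_commutator (gen_op p h) (gen_op q g) :: ('i, 'v) local_op) =
    (\<lambda>n \<kappa>. (if (case g of X _ \<Rightarrow> q | Planted _ _ \<Rightarrow> p) = 0 \<and> 0 < m then bracket_op (m - 1) g h n \<kappa> else 0)
      + nested_op p q g h n \<kappa> - nested_op q p h g n \<kappa>)"
    using assms by (intro ext) (simp only: local_commutator_gen_op)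
  then show ?thesis
    by (simp only: node_sum_commutator[OF is_local_gen_op is_local_gen_op] node_sum_diff node_sum_add node_sum_if)
qed

lemma omega_coeff_X: "omega_coeff m x (basis_vec (X j)) = 0"
  by (rule linear_eq_basis[OF linear_omega_coeff(2) linear_zero]) (simp add: omega_coeff_basis)

text \<open>Both sides are compared through the commutator formula summed over all splittings of m.
  The bracket term occurs once in each: where m - i = 1, and where the monomial has order 0. For k =
  X_j everything vanishes.\<close>

lemma omega_assoc_basis:
  "(\<Sum>i\<le>m. omega_coeff i (pi_coeff (m - i) (basis_vec g) (basis_vec h)
      + omega_coeff (m - i) (basis_vec g) (basis_vec h) - omega_coeff (m - i) (basis_vec h) (basis_vec g)) (basis_vec k)) =
    (\<Sum>i\<le>m. omega_coeff i (basis_vec g) (omega_coeff (m - i) (basis_vec h) (basis_vec k))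
      - omega_coeff i (basis_vec h) (omega_coeff (m - i) (basis_vec g) (basis_vec k)))"
proof (cases k)
  case (Planted c \<tau>)
  let ?N = "\<lambda>L. node_sum L (tree_of \<tau>) (planted c)"
  let ?NN = "\<lambda>L M. node_sum L (tree_of \<tau>) (\<lambda>t. node_sum M t (planted c))"
  let ?B = "if 0 < m then ?N (bracket_op (m - 1) g h) else 0"
  have "(\<Sum>i\<le>m. omega_coeff i (pi_coeff (m - i) (basis_vec g) (basis_vec h)
      + omega_coeff (m - i) (basis_vec g) (basis_vec h) - omega_coeff (m - i) (basis_vec h) (basis_vec g)) (basis_vec k)) =
    (\<Sum>i\<le>m. if m - i = 1 then ?N (bracket_op i g h) else 0) + (\<Sum>i\<le>m. ?N (nested_op i (m - i) g h))
      - (\<Sum>i\<le>m. ?N (nested_op i (m - i) h g))"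
    unfolding Planted linear_diff[OF linear_omega_coeff(2)] linear_add[OF linear_omega_coeff(2)]
      omega_pi_left omega_omega_left sum.distrib sum_subtractf ..
  moreover have "(\<Sum>i\<le>m. if m - i = 1 then ?N (bracket_op i g h) else 0) = ?B"
    by (rule sum_le_single)
  moreover have "(\<Sum>i\<le>m. omega_coeff i (basis_vec g) (omega_coeff (m - i) (basis_vec h) (basis_vec k))
      - omega_coeff i (basis_vec h) (omega_coeff (m - i) (basis_vec g) (basis_vec k))) =
    (\<Sum>i\<le>m. ?NN (gen_op (m - i) h) (gen_op i g)) - (\<Sum>i\<le>m. ?NN (gen_op (m - i) g) (gen_op i h))"
    unfolding Planted omega_omega_right sum_subtractf ..
  \<comment> \<open>The order i is now attached to \<open>g\<close> in both sums, as the commutator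
    formula requires.\<close>
  moreover have "(\<Sum>i\<le>m. ?NN (gen_op (m - i) g) (gen_op i h)) = (\<Sum>i\<le>m. ?NN (gen_op i g) (gen_op (m - i) h))"
    by (rule sum_le_reverse[symmetric])
  moreover have "(\<Sum>i\<le>m. ?NN (gen_op (m - i) h) (gen_op i g)) - (\<Sum>i\<le>m. ?NN (gen_op i g) (gen_op (m - i) h)) =
    (\<Sum>i\<le>m. if (case g of X _ \<Rightarrow> i | Planted _ _ \<Rightarrow> m - i) = 0 \<and> 0 < m then ?N (bracket_op (m - 1) g h) else 0)
      + (\<Sum>i\<le>m. ?N (nested_op (m - i) i g h)) - (\<Sum>i\<le>m. ?N (nested_op i (m - i) h g))"
    unfolding sum_subtractf[symmetric] sum.distrib[symmetric]
    by (intro sum.cong refl node_sum_commutator_gen_op) simp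
  \<comment> \<open>For positive m exactly one i passes the test: i = 0 if \<open>g\<close> is a
    monomial, and i = m otherwise.\<close>
  moreover have "(\<Sum>i\<le>m. if (case g of X _ \<Rightarrow> i | Planted _ _ \<Rightarrow> m - i) = 0 \<and> 0 < m then ?N (bracket_op (m - 1) g h) else 0) = ?B"
  proof -
    have "(\<Sum>i\<le>m. if (case g of X _ \<Rightarrow> i | Planted _ _ \<Rightarrow> m - i) = 0 \<and> 0 < m then ?N (bracket_op (m - 1) g h) else 0) =
      (\<Sum>i\<le>m. if i = (case g of X _ \<Rightarrow> 0 | Planted _ _ \<Rightarrow> m) then ?B else 0)"
      by (intro sum.cong) (auto split: gen.splits)
    then show ?thesis
      by (simp split: gen.splits)
  qed
  moreover have "(\<Sum>i\<le>m. ?N (nested_op (m - i) i g h)) = (\<Sum>i\<le>m. ?N (nested_op i (m - i) g h))"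
    by (rule sum_le_reverse[symmetric])
  ultimately show ?thesis
    by (simp only:)
qed (simp add: omega_coeff_X linear_0[OF linear_omega_coeff(1)])

section \<open>The bracket pi_1: antisymmetry, derivation property, Jacobi identity\<close>

lemma pi_coeff_basis: "pi_coeff 1 (basis_vec g) (basis_vec h) = pi1_gen g h"
  by (simp add: pi_coeff_eq bilinear_ext_basis)

lemma pi_coeff_0: "m \<noteq> 1 \<Longrightarrow> pi_coeff m x y = 0"
  by (simp add: pi_coeff_eq)

lemma pi_coeff_antisym: "pi_coeff m x y = - pi_coeff m y x"
proof (cases "m = 1")
  case True
  have gen: "pi1_gen g h = - pi1_gen h g" for g h :: "'a gen"
    by (cases g; cases h) auto
  have "pi_coeff m (basis_vec g) y = - pi_coeff m y (basis_vec g)" for g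
    by (rule linear_eq_basis[where x = y])
      (auto simp: True pi_coeff_basis[unfolded One_nat_def] intro!: linear_pi_coeff linear_compose_neg intro: gen)
  then show ?thesis
    by (intro linear_eq_basis[where x = x and f = "\<lambda>x. pi_coeff m x y"])
      (auto intro!: linear_pi_coeff linear_compose_neg)
qed (simp add: pi_coeff_0)

lemma pi_coeff_alternating: "pi_coeff m x x = 0"
  using pi_coeff_antisym[of m x x] by (metis add.right_inverse scaleR_2 scaleR_eq_0_iff zero_neq_numeral)

text \<open>Bracketing with X_j changes only the decoration \<open>b\<close> of the edge at the
  root, while the node sum changes only the tree above that edge.\<close>

lemma pi_node_sum:
  assumes "is_local L" "decorated t"
  shows "pi_coeff 1 (node_sum L t (planted b)) (basis_vec (X j)) =
      (if axis j 1 \<le> b then node_sum L t (planted (b - axis j 1)) else 0)"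
    and "pi_coeff 1 (basis_vec (X j)) (node_sum L t (planted b)) =
      - (if axis j 1 \<le> b then node_sum L t (planted (b - axis j 1)) else 0)"
    and "pi_coeff 1 (node_sum L t (planted b)) (basis_vec (Planted c \<tau>)) = 0"
    and "pi_coeff 1 (basis_vec (Planted c \<tau>)) (node_sum L t (planted b)) = 0"
proof -
  note linear_of = linear_of_node_sum[OF _ assms] and lc = node_sum_lincomb[OF assms(1)]
  have "pi_coeff 1 (node_sum L t (planted b)) (basis_vec (X j)) =
      node_sum L t (\<lambda>v. if axis j 1 \<le> b then planted (b - axis j 1) v else 0)"
    by (rule linear_of[OF linear_pi_coeff(2)]) (simp add: planted_def pi_coeff_basis[unfolded One_nat_def] lower_I_def)
  then show "pi_coeff 1 (node_sum L t (planted b)) (basis_vec (X j)) =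
      (if axis j 1 \<le> b then node_sum L t (planted (b - axis j 1)) else 0)"
    by (auto simp: lincomb_fun_zero[OF lc])
  then show "pi_coeff 1 (basis_vec (X j)) (node_sum L t (planted b)) =
      - (if axis j 1 \<le> b then node_sum L t (planted (b - axis j 1)) else 0)"
    by (subst pi_coeff_antisym) simp
  have "pi_coeff 1 (node_sum L t (planted b)) (basis_vec (Planted c \<tau>)) = node_sum L t (\<lambda>_. 0)"
    by (rule linear_of[OF linear_pi_coeff(2)]) (simp add: planted_def pi_coeff_basis[unfolded One_nat_def])
  then show "pi_coeff 1 (node_sum L t (planted b)) (basis_vec (Planted c \<tau>)) = 0"
    by (simp add: lincomb_fun_zero[OF lc])
  then show "pi_coeff 1 (basis_vec (Planted c \<tau>)) (node_sum L t (planted b)) = 0"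
    by (subst pi_coeff_antisym) simp
qed

text \<open>Lowering the root edge commutes with acting on the tree, by \<open>pi_node_sum\<close>;
  the remaining term vanishes because omega_m(g, X_j) = 0.\<close>

lemma omega_derivation_basis:
  "omega_coeff m (basis_vec g) (pi_coeff 1 (basis_vec h) (basis_vec k)) =
    pi_coeff 1 (omega_coeff m (basis_vec g) (basis_vec h)) (basis_vec k)
    + pi_coeff 1 (basis_vec h) (omega_coeff m (basis_vec g) (basis_vec k))"
  by (cases h; cases k; simp only: pi_coeff_basis pi1_gen.simps lower_I_def omega_coeff_basis
      pi_node_sum[OF is_local_gen_op decorated_tree_of] linear_0[OF linear_pi_coeff(1)]
      linear_0[OF linear_pi_coeff(2)] linear_0[OF linear_omega_coeff(1)] linear_neg[OF linear_omega_coeff(1)])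
    (auto simp: omega_coeff_basis linear_0[OF linear_omega_coeff(1)])

text \<open>Written with the sum e_j + e_k to make the symmetry in j and k visible.\<close>

lemma lower_twice:
  "pi_coeff 1 (lower_I a \<tau> j) (basis_vec (X k)) =
    (if axis j 1 + axis k 1 \<le> a then basis_vec (Planted (a - (axis j 1 + axis k 1)) \<tau>) else 0)"
proof -
  have "axis j 1 \<le> a \<and> axis k 1 \<le> a - axis j 1 \<longleftrightarrow> axis j 1 + axis k 1 \<le> a"
  proof -
    have "p \<le> a \<and> q \<le> a - p \<longleftrightarrow> p + q \<le> a" for p q :: "nat ^ 'a"
      unfolding less_eq_vec_def
      by (auto simp: all_conj_distrib[symmetric] le_diff_conv2 add.commute intro: add_leD1)
        (metis add.commute add_leD1 add_le_imp_le_diff le_diff_conv2)+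
    then show ?thesis .
  qed
  moreover have "a - axis j 1 - axis k 1 = a - (axis j 1 + axis k 1)"
    by (simp add: vec_eq_iff)
  ultimately show ?thesis
    by (auto simp: lower_I_def pi_coeff_basis[unfolded One_nat_def] linear_0[OF linear_pi_coeff(2)])
qed

text \<open>With at least two planted trees, or none, all iterated brackets vanish; with exactly
  one, the two lowerings commute by \<open>lower_twice\<close> and cancel.\<close>

lemma pi_jacobi_basis:
  "pi_coeff 1 (basis_vec g) (pi_coeff 1 (basis_vec h) (basis_vec k))
    + pi_coeff 1 (basis_vec h) (pi_coeff 1 (basis_vec k) (basis_vec g))
    + pi_coeff 1 (basis_vec k) (pi_coeff 1 (basis_vec g) (basis_vec h)) = 0"
proof -
  have X: "pi_coeff 1 (basis_vec (X j)) v = - pi_coeff 1 v (basis_vec (X j))" for j and v :: "'a V"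
    by (rule pi_coeff_antisym)
  have P: "pi_coeff 1 (basis_vec (Planted a \<sigma>)) (lower_I b \<tau> j) = 0" for a b \<sigma> j and \<tau> :: "'a dtree"
    by (simp add: lower_I_def pi_coeff_basis[unfolded One_nat_def] linear_0[OF linear_pi_coeff(1)])
  note lin = linear_0[OF linear_pi_coeff(1)] linear_0[OF linear_pi_coeff(2)]
    linear_neg[OF linear_pi_coeff(1)] linear_neg[OF linear_pi_coeff(2)]
  show ?thesis
    unfolding pi_coeff_basis
    by (cases g; cases h; cases k; simp only: pi1_gen.simps lin P)
      (simp_all only: X lin lower_twice, simp_all add: add.commute)
qed

section \<open>Assembly of the deformation\<close>

lemma post_lie_deformation_series:
  "post_lie_algebra fps_act
     (series_op (pi_coeff :: nat \<Rightarrow> ('i::finite) V \<Rightarrow> 'i V \<Rightarrow> 'i V))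
     (series_op (omega_coeff :: nat \<Rightarrow> 'i V \<Rightarrow> 'i V \<Rightarrow> 'i V))"
proof (rule post_lie_algebra_series)
  fix n :: nat and x y z :: "'i V"
  have pi_pi: "pi_coeff 1 x (pi_coeff 1 y z) + pi_coeff 1 y (pi_coeff 1 z x)
      + pi_coeff 1 z (pi_coeff 1 x y) = 0"
    by (rule trilinear_eq_basis[where G = "\<lambda>_ _ _. 0" and F = "\<lambda>x y z. pi_coeff 1 x (pi_coeff 1 y z)
        + pi_coeff 1 y (pi_coeff 1 z x) + pi_coeff 1 z (pi_coeff 1 x y)"])
      (intro linear_coeff linear_zero pi_jacobi_basis)+
  \<comment> \<open>This can be nonzero only for i = n - i = 1, that is, in the coefficient of
    t^2.\<close>
  have "pi_coeff i u (pi_coeff (n - i) v w) =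
      (if n - i = 1 then (if i = 1 then pi_coeff 1 u (pi_coeff 1 v w) else 0) else 0)"
    for i and u v w :: "'i V"
    by (auto simp: pi_coeff_0[unfolded One_nat_def] linear_0[OF linear_pi_coeff(1)])
  then show "(\<Sum>i\<le>n. pi_coeff i x (pi_coeff (n - i) y z) + pi_coeff i y (pi_coeff (n - i) z x)
      + pi_coeff i z (pi_coeff (n - i) x y)) = 0"
    using pi_pi by (intro sum.neutral) simp
  have der: "omega_coeff m x (pi_coeff 1 y z) =
      pi_coeff 1 (omega_coeff m x y) z + pi_coeff 1 y (omega_coeff m x z)" for m
    by (rule trilinear_eq_basis[where F = "\<lambda>x y z. omega_coeff m x (pi_coeff 1 y z)" and
          G = "\<lambda>x y z. pi_coeff 1 (omega_coeff m x y) z + pi_coeff 1 y (omega_coeff m x z)"])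
      (intro linear_coeff omega_derivation_basis)+
  \<comment> \<open>Since pi_t = pi_1 t, only i = n - 1 survives on the left and i = 1 on the right;
    both leave omega of order n - 1.\<close>
  have "(\<Sum>i\<le>n. omega_coeff i x (pi_coeff (n - i) y z)) =
      (\<Sum>i\<le>n. if n - i = 1 then omega_coeff i x (pi_coeff 1 y z) else 0)"
    by (intro sum.cong refl) (simp add: pi_coeff_0 linear_0[OF linear_omega_coeff(1)])
  moreover have "(\<Sum>i\<le>n. pi_coeff i (omega_coeff (n - i) x y) z + pi_coeff i y (omega_coeff (n - i) x z)) =
      (\<Sum>i\<le>n. if i = 1 then pi_coeff 1 (omega_coeff (n - i) x y) z + pi_coeff 1 y (omega_coeff (n - i) x z) else 0)"
    by (intro sum.cong refl) (simp add: pi_coeff_0)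
  ultimately show "(\<Sum>i\<le>n. omega_coeff i x (pi_coeff (n - i) y z)) =
      (\<Sum>i\<le>n. pi_coeff i (omega_coeff (n - i) x y) z + pi_coeff i y (omega_coeff (n - i) x z))"
    unfolding sum_le_single der by simp
  show "(\<Sum>i\<le>n. omega_coeff i (pi_coeff (n - i) x y + omega_coeff (n - i) x y - omega_coeff (n - i) y x) z) =
      (\<Sum>i\<le>n. omega_coeff i x (omega_coeff (n - i) y z) - omega_coeff i y (omega_coeff (n - i) x z))"
    by (rule trilinear_eq_basis[where
          F = "\<lambda>x y z. \<Sum>i\<le>n. omega_coeff i (pi_coeff (n - i) x y + omega_coeff (n - i) x y - omega_coeff (n - i) y x) z"
          and G = "\<lambda>x y z. \<Sum>i\<le>n. omega_coeff i x (omega_coeff (n - i) y z) - omega_coeff i y (omega_coeff (n - i) x z)"])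
      (intro linear_coeff omega_assoc_basis ballI)+
qed (intro bilinear_pi_coeff bilinear_omega_coeff pi_coeff_alternating)+

lemma pre_lie_algebra_prelie: "pre_lie_algebra (*\<^sub>R) (prelie :: ('i::finite) V \<Rightarrow> 'i V \<Rightarrow> 'i V)"
  unfolding pre_lie_algebra_def
proof (intro post_lie_algebra.intro post_lie_algebra_axioms.intro)
  have prelie: "prelie = (omega_coeff 0 :: 'i V \<Rightarrow> 'i V \<Rightarrow> 'i V)"
    by (simp add: omega_coeff_def)
  have op: "bilinear_op (*\<^sub>R) f" if "bilinear f" for f :: "'i V \<Rightarrow> 'i V \<Rightarrow> 'i V"
    using that unfolding bilinear_op_def bilinear_def
    by (simp add: module_hom_iff_linear linear_def)
  show "module ((*\<^sub>R) :: real \<Rightarrow> 'i V \<Rightarrow> 'i V)"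
    by (rule real_vector.module_axioms)
  show "bilinear_op (*\<^sub>R) (\<lambda>_ _ :: 'i V. 0 :: 'i V)" "bilinear_op (*\<^sub>R) (prelie :: 'i V \<Rightarrow> 'i V \<Rightarrow> 'i V)"
    unfolding prelie by (intro op bilinear_zero bilinear_omega_coeff)+
  fix x y z :: "'i V"
  \<comment> \<open>The coefficient of t^0 in the post-Lie identity, where pi_0 = 0.\<close>
  have "omega_coeff 0 (omega_coeff 0 x y - omega_coeff 0 y x) z =
      omega_coeff 0 x (omega_coeff 0 y z) - omega_coeff 0 y (omega_coeff 0 x z)"
    by (rule trilinear_eq_basis[where
          F = "\<lambda>x y z. omega_coeff 0 (omega_coeff 0 x y - omega_coeff 0 y x) z"
          and G = "\<lambda>x y z. omega_coeff 0 x (omega_coeff 0 y z) - omega_coeff 0 y (omega_coeff 0 x z)"])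
      ((intro linear_coeff)+, use omega_assoc_basis[where m = 0] in \<open>simp add: pi_coeff_0\<close>)
  then show "prelie (0 + prelie x y - prelie y x) z = prelie x (prelie y z) - prelie y (prelie x z)"
    by (simp add: prelie)
qed (simp_all add: linear_0[OF linear_omega_coeff(1), of 0, unfolded omega_coeff_def, simplified])

theorem theorem4p8:
  shows "post_lie_algebra fps_act
           (series_op (pi_coeff :: nat \<Rightarrow> ('i::finite) V \<Rightarrow> 'i V \<Rightarrow> 'i V))
           (series_op (omega_coeff :: nat \<Rightarrow> 'i V \<Rightarrow> 'i V \<Rightarrow> 'i V)) \<and>
         formal_post_lie_deformation (prelie :: 'i V \<Rightarrow> 'i V \<Rightarrow> 'i V) pi_coeff omega_coeff"
  unfolding formal_post_lie_deformation_def
  by (intro conjI allI post_lie_deformation_series pre_lie_algebra_prelie bilinear_pi_coeff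
      pi_coeff_alternating bilinear_omega_coeff)
    (simp_all add: pi_coeff_def omega_coeff_def)

end
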